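(* For the complete graph $K_1$ (a single vertex), the only realizable group and the only positively realizable group is the trivial group. For the complete graph $K_2$ (a single edge with its two endpoints), the only realizable group and the only positively realizable group is $\mathbb{Z}_2$ (all groups up to isomorphism).
   Context: Embeddings of graphs in the 3-sphere $S^3$ are tame (e.g. piecewise linear). For an embedding $\Gamma$ of an abstract graph $\gamma$ in $S^3$, a homeomorphism of $(S^3,\Gamma)$ is a homeomorphism of $S^3$ taking $\Gamma$ to itself, with vertices going to vertices and edges to edges; it induces an automorphism of $\gamma$. The topological symmetry group $\mathrm{TSG}(\Gamma)$ is the subgroup of $\mathrm{Aut}(\gamma)$ consisting of the automorphisms induced by homeomorphisms of $(S^3,\Gamma)$, and $\mathrm{TSG}_+(\Gamma)$ is the subgroup of those induced by orientation preserving homeomorphisms of $(S^3,\Gamma)$. A group $G$ is realizable for $\gamma$ if there is an embedding $\Gamma$ of $\gamma$ in $S^3$ with $\mathrm{TSG}(\Gamma)\cong G$, and positively realizable for $\gamma$ if there is an embedding $\Gamma$ of $\gamma$ in $S^3$ with $\mathrm{TSG}_+(\Gamma)\cong G$. $\mathbb{Z}_m$ is the cyclic group of order $m$. *)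

theory Defs
  imports
    "HOL-Algebra.Elementary_Groups"
    "HOL-Algebra.Bij"
    "HOL-Homology.Homology"
begin

record 'v ugraph =
  vertices :: "'v set"
  edges :: "'v set set"

definition finite_simple_graph :: "'v ugraph \<Rightarrow> bool" where
  "finite_simple_graph \<gamma> \<longleftrightarrow>
     finite (vertices \<gamma>) \<and> (\<forall>e\<in>edges \<gamma>. e \<subseteq> vertices \<gamma> \<and> card e = 2)"

definition complete_graph :: "nat \<Rightarrow> nat ugraph" where
  "complete_graph n = \<lparr>vertices = {..<n}, edges = {e. e \<subseteq> {..<n} \<and> card e = 2}\<rparr>"

lemma finite_simple_graph_complete_graph: "finite_simple_graph (complete_graph n)"
  by (simp add: finite_simple_graph_def complete_graph_def)

text \<open>An automorphism of a simple graph is determined by its action on the vertices.  As in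
  \<^const>\<open>BijGroup\<close>, the permutations are taken to be \<^const>\<open>undefined\<close> off the vertex set.\<close>

definition graph_automorphisms :: "'v ugraph \<Rightarrow> ('v \<Rightarrow> 'v) set" where
  "graph_automorphisms \<gamma> =
     {\<sigma> \<in> Bij (vertices \<gamma>).
        \<forall>u\<in>vertices \<gamma>. \<forall>v\<in>vertices \<gamma>. {\<sigma> u, \<sigma> v} \<in> edges \<gamma> \<longleftrightarrow> {u, v} \<in> edges \<gamma>}"

definition Aut :: "'v ugraph \<Rightarrow> ('v \<Rightarrow> 'v) monoid" where
  "Aut \<gamma> = (BijGroup (vertices \<gamma>))\<lparr>carrier := graph_automorphisms \<gamma>\<rparr>"


text \<open>The geometric realization of a finite simple graph, in barycentric coordinates: the vertex
  \<open>v\<close> is the function \<open>indicator {v}\<close>, and the closed edge \<open>e = {u, v}\<close> is the segment of convex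
  combinations of \<open>u\<close> and \<open>v\<close>.\<close>

definition vertex_point :: "'v \<Rightarrow> 'v \<Rightarrow> real" where
  "vertex_point v = indicator {v}"

definition closed_edge :: "'v set \<Rightarrow> ('v \<Rightarrow> real) set" where
  "closed_edge e = {x. (\<forall>i. 0 \<le> x i) \<and> (\<forall>i. i \<notin> e \<longrightarrow> x i = 0) \<and> sum x e = 1}"

definition realization :: "'v ugraph \<Rightarrow> ('v \<Rightarrow> real) topology" where
  "realization \<gamma> =
     subtopology (powertop_real UNIV)
       (vertex_point ` vertices \<gamma> \<union> (\<Union>e\<in>edges \<gamma>. closed_edge e))"

abbreviation S3 :: "(nat \<Rightarrow> real) topology" where
  "S3 \<equiv> nsphere 3"

text \<open>Tameness of a proper subset of the 3-sphere.  A homeomorphism from the complement of a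
  point \<open>p\<close> onto 3-space extends to a homeomorphism from the 3-sphere onto the one-point
  compactification of 3-space, sending \<open>p\<close> to infinity.  So the condition says that some
  homeomorphism of the 3-sphere carries \<open>\<Gamma>\<close> to a piecewise linear graph.  Degenerate segments
  are single points.\<close>

definition tame :: "(nat \<Rightarrow> real) set \<Rightarrow> bool" where
  "tame \<Gamma> \<longleftrightarrow>
     (\<exists>p h S. p \<in> topspace S3 - \<Gamma> \<and>
        homeomorphic_map (subtopology S3 (topspace S3 - {p})) (euclidean :: (real ^ 3) topology) h \<and>
        finite S \<and> h ` \<Gamma> = (\<Union>(a, b)\<in>S. closed_segment a b))"

text \<open>An embedding of \<open>\<gamma>\<close> is given by a map \<open>f\<close> on its realization; the embedded graph \<open>\<Gamma>\<close> is
  the image of \<open>f\<close>, with vertices \<open>f (vertex_point v)\<close> and edges \<open>f ` closed_edge e\<close>.\<close>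

definition tame_embedding :: "'v ugraph \<Rightarrow> (('v \<Rightarrow> real) \<Rightarrow> nat \<Rightarrow> real) \<Rightarrow> bool" where
  "tame_embedding \<gamma> f \<longleftrightarrow>
     embedding_map (realization \<gamma>) S3 f \<and> tame (f ` topspace (realization \<gamma>))"

definition graph_homeomorphism ::
    "'v ugraph \<Rightarrow> (('v \<Rightarrow> real) \<Rightarrow> nat \<Rightarrow> real) \<Rightarrow> ((nat \<Rightarrow> real) \<Rightarrow> nat \<Rightarrow> real) \<Rightarrow> bool" where
  "graph_homeomorphism \<gamma> f h \<longleftrightarrow>
     homeomorphic_map S3 S3 h \<and>
     h ` (f ` topspace (realization \<gamma>)) = f ` topspace (realization \<gamma>) \<and>
     (\<forall>v\<in>vertices \<gamma>. \<exists>w\<in>vertices \<gamma>. h (f (vertex_point v)) = f (vertex_point w)) \<and>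
     (\<forall>e\<in>edges \<gamma>. \<exists>e'\<in>edges \<gamma>. h ` (f ` closed_edge e) = f ` closed_edge e')"

definition orientation_preserving :: "((nat \<Rightarrow> real) \<Rightarrow> nat \<Rightarrow> real) \<Rightarrow> bool" where
  "orientation_preserving h \<longleftrightarrow> Brouwer_degree2 3 h = 1"

definition induces ::
    "'v ugraph \<Rightarrow> (('v \<Rightarrow> real) \<Rightarrow> nat \<Rightarrow> real) \<Rightarrow> ((nat \<Rightarrow> real) \<Rightarrow> nat \<Rightarrow> real) \<Rightarrow> ('v \<Rightarrow> 'v) \<Rightarrow> bool" where
  "induces \<gamma> f h \<sigma> \<longleftrightarrow>
     (\<forall>v\<in>vertices \<gamma>. h (f (vertex_point v)) = f (vertex_point (\<sigma> v))) \<and>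
     (\<forall>e\<in>edges \<gamma>. h ` (f ` closed_edge e) = f ` closed_edge (\<sigma> ` e))"

definition TSG :: "'v ugraph \<Rightarrow> (('v \<Rightarrow> real) \<Rightarrow> nat \<Rightarrow> real) \<Rightarrow> ('v \<Rightarrow> 'v) monoid" where
  "TSG \<gamma> f = (Aut \<gamma>)
     \<lparr>carrier := {\<sigma> \<in> carrier (Aut \<gamma>). \<exists>h. graph_homeomorphism \<gamma> f h \<and> induces \<gamma> f h \<sigma>}\<rparr>"

definition TSG_plus :: "'v ugraph \<Rightarrow> (('v \<Rightarrow> real) \<Rightarrow> nat \<Rightarrow> real) \<Rightarrow> ('v \<Rightarrow> 'v) monoid" where
  "TSG_plus \<gamma> f = (Aut \<gamma>)
     \<lparr>carrier := {\<sigma> \<in> carrier (Aut \<gamma>).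
        \<exists>h. graph_homeomorphism \<gamma> f h \<and> orientation_preserving h \<and> induces \<gamma> f h \<sigma>}\<rparr>"

definition realizable :: "'v ugraph \<Rightarrow> ('a, 'b) monoid_scheme \<Rightarrow> bool" where
  "realizable \<gamma> G \<longleftrightarrow> (\<exists>f. tame_embedding \<gamma> f \<and> TSG \<gamma> f \<cong> G)"

definition positively_realizable :: "'v ugraph \<Rightarrow> ('a, 'b) monoid_scheme \<Rightarrow> bool" where
  "positively_realizable \<gamma> G \<longleftrightarrow> (\<exists>f. tame_embedding \<gamma> f \<and> TSG_plus \<gamma> f \<cong> G)"

end

(* A homeomorphism from the complement of a point of the 3-sphere onto 3-space turns a tame embedding
   of K_2 into a polygonal arc.  Such an arc is unknotted: near each of its points a piecewise linear
   shear straightens it, and then a homeomorphism supported near that point slides the free end of the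
   arc along itself.  So all initial pieces g [0, t], t > 0, are equivalent under homeomorphisms of the
   space, and a short one is a segment.  The half turn of that segment, the square of a quarter turn k,
   therefore gives a homeomorphism of 3-space that exchanges the ends of the arc.  It extends over the
   removed point, and it preserves orientation because deg(k)^2 = 1. *)

theory Submission
  imports Defs "HOL-Analysis.Lipschitz" "HOL-Analysis.Cartesian_Euclidean_Space"
begin

subsection \<open>Straightening and sliding homeomorphisms\<close>

text \<open>Tameness constrains only the image set: it is a finite union of segments, which may
  overlap, and the parametrization is merely continuous. So no ordered list of vertices is available
  for an induction. What remains usable is local: around every point the image is a cone. A
  continuous injective real function on an interval is monotone, and this sorts the radii of the
  cone into those that arrive and those that leave, at most one of each. Connectedness of
  \<open>{0<..1}\<close> then takes the place of an induction over edges. Knotting is no obstacle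
  because each slide happens in a ball that meets the arc in a single straight strand; the rest of
  the arc lies outside and stays fixed. The turn is built as a square because the degree of a
  homeomorphism of the sphere is known only up to sign. Squaring removes the sign, so no degree is
  ever computed. On the group side, every permutation of the vertices of a complete graph is an
  automorphism; once all of them are induced, both symmetry groups are the full symmetric group, for
  every tame embedding.\<close>

definition self_homeomorphism :: "('a::topological_space \<Rightarrow> 'a) \<Rightarrow> bool" where
  "self_homeomorphism f \<longleftrightarrow> (\<exists>g. homeomorphism UNIV UNIV f g)"

lemma self_homeomorphism_compose:
  assumes "self_homeomorphism f" "self_homeomorphism g"
  shows "self_homeomorphism (g \<circ> f)"
  using assms homeomorphism_compose unfolding self_homeomorphism_def by blast

lemma self_homeomorphism_bij: "self_homeomorphism f \<Longrightarrow> bij f"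
  unfolding self_homeomorphism_def homeomorphism_def bij_def inj_def by (metis UNIV_I)

lemma self_homeomorphism_continuous: "self_homeomorphism f \<Longrightarrow> continuous_on S f"
  by (meson continuous_on_subset homeomorphism_def self_homeomorphism_def subset_UNIV)

lemma self_homeomorphism_inv:
  assumes "self_homeomorphism f" shows "self_homeomorphism (inv_into UNIV f)"
proof -
  obtain g where g: "homeomorphism UNIV UNIV f g"
    using assms self_homeomorphism_def by blast
  then have "inv_into UNIV f = g"
    by (intro inv_equality) (auto simp: homeomorphism_def)
  then show ?thesis
    using g homeomorphism_symD self_homeomorphism_def by blast
qed

lemma self_homeomorphism_translation: "self_homeomorphism (\<lambda>x::'a::real_normed_vector. x - p)"
  unfolding self_homeomorphism_def homeomorphism_def
  by (rule exI[of _ "\<lambda>x. x + p"]) (auto intro!: continuous_intros simp: image_iff intro: exI[of _ "_ + p"] exI[of _ "_ - p"])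

lemma self_homeomorphismI:
  assumes "continuous_on UNIV f" "continuous_on UNIV g" "\<And>x. g (f x) = x" "\<And>y. f (g y) = y"
  shows "self_homeomorphism f"
  unfolding self_homeomorphism_def homeomorphism_def using assms by (metis surjI)

text \<open>Surjectivity is Banach's fixed point theorem for the contraction that sends
  \<open>x\<close> to \<open>y - g x\<close>. The perturbed map shrinks distances by at most the
  factor \<open>1 - c\<close>, so it is injective and its inverse is Lipschitz.\<close>

lemma self_homeomorphism_contractive_perturbation:
  fixes g :: "'a::banach \<Rightarrow> 'a"
  assumes "0 \<le> c" "c < 1" and lip: "\<And>x y. norm (g x - g y) \<le> c * norm (x - y)"
  shows "self_homeomorphism (\<lambda>x. x + g x)"
proof -
  define f where "f = (\<lambda>x. x + g x)"
  have expand: "(1 - c) * norm (x - y) \<le> norm (f x - f y)" for x y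
  proof -
    have "norm (x - y) \<le> norm (f x - f y) + norm (g x - g y)"
      using norm_triangle_ineq4[of "f x - f y" "g x - g y"] by (simp add: f_def algebra_simps)
    then show ?thesis using lip[of x y] by (simp add: algebra_simps)
  qed
  have "\<exists>x. f x = y" for y
  proof -
    have "\<forall>x x'. dist (y - g x) (y - g x') \<le> c * dist x x'"
      using lip by (simp add: dist_norm norm_minus_commute) 
    from banach_fix_type[OF assms(1,2) this] obtain x where "y - g x = x" by blast
    then show ?thesis by (metis diff_add_cancel f_def)
  qed
  then obtain h where h: "\<And>y. f (h y) = y" by metis
  have hf: "h (f x) = x" for x
    using expand[of "h (f x)" x] h assms(2) by (simp add: mult_le_0_iff)
  have "lipschitz_on c UNIV g"
    using lip assms(1) by (auto intro!: lipschitz_onI simp: dist_norm)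
  then have "continuous_on UNIV f"
    unfolding f_def by (intro continuous_intros lipschitz_on_continuous_on)
  moreover have "lipschitz_on (1 / (1 - c)) UNIV h"
  proof (rule lipschitz_onI)
    show "dist (h x) (h y) \<le> 1 / (1 - c) * dist x y" for x y
      using expand[of "h x" "h y"] h assms(2) by (simp add: dist_norm field_simps)
  qed (use assms in auto)
  then have "continuous_on UNIV h" by (rule lipschitz_on_continuous_on)
  ultimately have "self_homeomorphism f"
    by (rule self_homeomorphismI[of f h, OF _ _ hf h])
  then show ?thesis by (simp add: f_def)
qed

text \<open>The map adds \<open>s *\<^sub>R e\<close> weighted by a tent function \<open>b\<close>
  that is 1 at the origin and 0 off the ball. The tent has Lipschitz constant
  \<open>1 / \<eta>\<close>, so the perturbation has constant
  \<open>\<bar>s\<bar> / \<eta> < 1\<close> and the preceding lemma applies.\<close>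

lemma push_along_line:
  fixes e :: "'a::banach"
  assumes e: "norm e = 1" and \<eta>: "0 < \<eta>" and s: "\<bar>s\<bar> < \<eta>"
  obtains f where "self_homeomorphism f" "\<And>x. x \<notin> ball 0 \<eta> \<Longrightarrow> f x = x" "f 0 = s *\<^sub>R e"
    "f ` ((\<lambda>t. t *\<^sub>R e) ` {-\<eta><..0}) = (\<lambda>t. t *\<^sub>R e) ` {-\<eta><..s}"
proof -
  define b where "b = (\<lambda>x::'a. max 0 (1 - norm x / \<eta>))"
  define f where "f = (\<lambda>x::'a. x + (b x * s) *\<^sub>R e)"
  have lipb: "\<bar>b x - b y\<bar> \<le> norm (x - y) / \<eta>" for x y
  proof -
    have "\<bar>b x - b y\<bar> \<le> \<bar>norm x / \<eta> - norm y / \<eta>\<bar>"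
      unfolding b_def by linarith
    also have "\<dots> = \<bar>norm x - norm y\<bar> / \<eta>"
      using \<eta> by (simp flip: diff_divide_distrib)
    also have "\<dots> \<le> norm (x - y) / \<eta>"
      using \<eta> norm_triangle_ineq3 by (intro divide_right_mono) auto
    finally show ?thesis .
  qed
  have "self_homeomorphism f"
    unfolding f_def
  proof (rule self_homeomorphism_contractive_perturbation)
    show "0 \<le> \<bar>s\<bar> / \<eta>" "\<bar>s\<bar> / \<eta> < 1" using \<eta> s by auto
    show "norm ((b x * s) *\<^sub>R e - (b y * s) *\<^sub>R e) \<le> \<bar>s\<bar> / \<eta> * norm (x - y)" for x y
    proof -
      have "norm ((b x * s) *\<^sub>R e - (b y * s) *\<^sub>R e) = \<bar>b x - b y\<bar> * \<bar>s\<bar>"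
        using e by (simp add: abs_mult flip: scaleR_left_diff_distrib left_diff_distrib)
      also have "\<dots> \<le> norm (x - y) / \<eta> * \<bar>s\<bar>"
        using lipb by (intro mult_right_mono) auto
      finally show ?thesis by (simp add: field_simps)
    qed
  qed
  moreover have "f x = x" if "x \<notin> ball 0 \<eta>" for x
    using that \<eta> by (simp add: f_def b_def)
  moreover have "f 0 = s *\<^sub>R e" by (simp add: f_def b_def)
  moreover have "f ` ((\<lambda>t. t *\<^sub>R e) ` {-\<eta><..0}) = (\<lambda>t. t *\<^sub>R e) ` {-\<eta><..s}"
  proof -
    \<comment> \<open>On this part of the axis the tent is \<open>1 + t / \<eta>\<close>, so the
      push is affine there: it fixes the end \<open>-\<eta>\<close> and moves 0 to
      \<open>s\<close>.\<close>
    have *: "f (t *\<^sub>R e) = ((1 + s / \<eta>) * t + s) *\<^sub>R e" if "t \<in> {-\<eta><..0}" for t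
      using that \<eta> e by (simp add: f_def b_def max_def field_simps flip: scaleR_left_distrib)
    have k: "1 + s / \<eta> > 0" using \<eta> s by (simp add: field_simps)
    have "(\<lambda>t. (1 + s / \<eta>) * t + s) ` {-\<eta><..0} = {-\<eta><..s}"
    proof (intro equalityI subsetI)
      fix u assume "u \<in> (\<lambda>t. (1 + s / \<eta>) * t + s) ` {-\<eta><..0}"
      then obtain t where t: "t \<in> {-\<eta><..0}" "u = (1 + s / \<eta>) * t + s" by auto
      have "(1 + s / \<eta>) * t > (1 + s / \<eta>) * (-\<eta>)"
        using t k by (intro mult_strict_left_mono) auto
      moreover have "(1 + s / \<eta>) * t \<le> 0" using t k by (simp add: mult_le_0_iff)
      moreover have "(1 + s / \<eta>) * (-\<eta>) = - \<eta> - s" using \<eta> by (simp add: field_simps)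
      ultimately show "u \<in> {-\<eta><..s}" using t(2) by auto
    next
      fix u assume u: "u \<in> {-\<eta><..s}"
      define t where "t = (u - s) / (1 + s / \<eta>)"
      have "u = (1 + s / \<eta>) * t + s" using k by (simp add: t_def)
      moreover have "t \<le> 0" using u k by (simp add: t_def field_simps)
      moreover have "- \<eta> * (1 + s / \<eta>) = - \<eta> - s" using \<eta> by (simp add: field_simps)
      then have "- \<eta> < t" using u k unfolding t_def pos_less_divide_eq[OF k] by auto
      ultimately show "u \<in> (\<lambda>t. (1 + s / \<eta>) * t + s) ` {-\<eta><..0}" by auto
    qed
    moreover have "f ` ((\<lambda>t. t *\<^sub>R e) ` {-\<eta><..0}) =
        (\<lambda>t. t *\<^sub>R e) ` (\<lambda>t. (1 + s / \<eta>) * t + s) ` {-\<eta><..0}"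
      unfolding image_image by (intro image_cong refl *)
    ultimately show ?thesis by simp
  qed
  ultimately show ?thesis using that by blast
qed

text \<open>Write \<open>a = w - c *\<^sub>R e\<close> and \<open>b = w + c *\<^sub>R e\<close>;
  equal norms make \<open>w\<close> orthogonal to \<open>e\<close>. The shear subtracts
  \<open>(\<bar>x \<bullet> e\<bar> / c) *\<^sub>R w\<close>, which cancels the \<open>w\<close>
  component on both radii. It leaves \<open>x \<bullet> e\<close> unchanged, so adding the same term
  back inverts it.\<close>

lemma straighten_corner:
  fixes a b :: "'a::real_inner"
  assumes "norm a = 1" "norm b = 1" "a \<noteq> b" "0 < r"
  obtains \<sigma> e \<eta> where "self_homeomorphism \<sigma>" "norm e = 1" "0 < \<eta>" "\<sigma> 0 = 0"
    "ball 0 \<eta> \<subseteq> \<sigma> ` ball 0 r"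
    "\<sigma> ` (\<lambda>(d, s). s *\<^sub>R d) ` ({a, b} \<times> {0..<r}) \<inter> ball 0 \<eta> = (\<lambda>s. s *\<^sub>R e) ` {-\<eta><..<\<eta>}"
proof -
  define c where "c = norm (b - a) / 2"
  define e where "e = (1 / (2 * c)) *\<^sub>R (b - a)"
  define w where "w = (1/2) *\<^sub>R (a + b)"
  have c: "c > 0" using assms by (simp add: c_def)
  have e: "norm e = 1" using c by (simp add: e_def c_def)
  have ab: "a = w - c *\<^sub>R e" "b = w + c *\<^sub>R e"
    using c by (auto simp: e_def w_def algebra_simps simp flip: scaleR_left_distrib)
  have we: "w \<bullet> e = 0"
    using assms by (simp add: w_def e_def inner_simps inner_commute dot_square_norm)
  have ee: "e \<bullet> e = 1" using e by (simp add: dot_square_norm)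
  define \<sigma> where "\<sigma> = (\<lambda>x. x - (\<bar>x \<bullet> e\<bar> / c) *\<^sub>R w)"
  have \<sigma>: "self_homeomorphism \<sigma>"
  proof (rule self_homeomorphismI)
    show "continuous_on UNIV \<sigma>" "continuous_on UNIV (\<lambda>x. x + (\<bar>x \<bullet> e\<bar> / c) *\<^sub>R w)"
      unfolding \<sigma>_def by (auto intro!: continuous_intros simp: c less_imp_neq[symmetric])
  qed (auto simp: \<sigma>_def inner_simps we)
  have \<sigma>b: "\<sigma> (s *\<^sub>R b) = (s * c) *\<^sub>R e" if "0 \<le> s" for s
    using that c by (simp add: \<sigma>_def ab inner_simps we ee algebra_simps abs_mult)
  have \<sigma>a: "\<sigma> (s *\<^sub>R a) = (- s * c) *\<^sub>R e" if "0 \<le> s" for s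
    using that c by (simp add: \<sigma>_def ab inner_simps we ee algebra_simps abs_mult)
  have \<sigma>0: "\<sigma> 0 = 0" by (simp add: \<sigma>_def)
  obtain \<tau> where \<tau>: "homeomorphism UNIV UNIV \<sigma> \<tau>"
    using \<sigma> self_homeomorphism_def by blast
  have "open (\<sigma> ` ball 0 r)"
    using homeomorphism_imp_open_map[OF \<tau>, of "ball 0 r"] by (simp)
  \<comment> \<open>The smaller ball must have its whole preimage inside \<open>ball 0 r\<close>,
    where the arc is known to be the cone; otherwise remote parts of the arc could enter it.\<close>
  then obtain \<eta> where \<eta>: "\<eta> > 0" "ball 0 \<eta> \<subseteq> \<sigma> ` ball 0 r"
    using \<open>0 < r\<close> \<sigma>0 by (metis centre_in_ball image_eqI openE)
  have inj: "inj \<sigma>" using self_homeomorphism_bij[OF \<sigma>] bij_is_inj by blast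
  have "\<sigma> ` (\<lambda>(d, s). s *\<^sub>R d) ` ({a, b} \<times> {0..<r}) \<inter> ball 0 \<eta> = (\<lambda>s. s *\<^sub>R e) ` {-\<eta><..<\<eta>}" (is "?L = ?R")
  proof (intro equalityI subsetI)
    fix x assume x: "x \<in> ?L"
    then obtain q where "q \<in> {a, b} \<times> {0..<r}" "x = \<sigma> (case q of (d, s) \<Rightarrow> s *\<^sub>R d)" by blast
    then obtain d s where "d = a \<or> d = b" "0 \<le> s" "x = \<sigma> (s *\<^sub>R d)"
      by (cases q) (simp, blast)
    then obtain s where "x = s *\<^sub>R e" using \<sigma>a \<sigma>b by metis
    moreover then have "\<bar>s\<bar> < \<eta>" using x e by auto
    ultimately show "x \<in> ?R" by (intro image_eqI[of _ _ s]) auto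
  next
    fix x assume "x \<in> ?R"
    then obtain s where "x = s *\<^sub>R e" "s \<in> {-\<eta><..<\<eta>}" by blast
    then have s: "x = s *\<^sub>R e" "\<bar>s\<bar> < \<eta>" by auto
    define d where "d = (if s \<ge> 0 then b else a)"
    have xd: "x = \<sigma> ((\<bar>s\<bar> / c) *\<^sub>R d)"
      using c \<sigma>a[of "- s / c"] \<sigma>b[of "s / c"] by (auto simp: d_def s divide_nonpos_pos)
    have xb: "x \<in> ball 0 \<eta>" using s e by simp
    then have "(\<bar>s\<bar> / c) *\<^sub>R d \<in> ball 0 r"
      using \<eta> xd inj by (metis (no_types, lifting) inj_image_mem_iff subsetD)
    then have "\<bar>s\<bar> / c < r" using assms c by (simp add: d_def split: if_splits)
    then have "(\<bar>s\<bar> / c) *\<^sub>R d \<in> (\<lambda>(d, s). s *\<^sub>R d) ` ({a, b} \<times> {0..<r})"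
      using c by (intro image_eqI[of _ _ "(d, \<bar>s\<bar> / c)"]) (auto simp: d_def)
    then show "x \<in> ?L" using xb xd by blast
  qed
  then show ?thesis using that \<sigma> e \<eta> \<sigma>0 by blast
qed

section \<open>Local cone structure of finite unions of segments\<close>

text \<open>A segment through \<open>p\<close> splits at \<open>p\<close> into two radii, and one
  that misses \<open>p\<close> misses a small ball. Cones survive shrinking the ball, so finitely
  many can be united at the smallest radius. The centre is removed so that the same formula serves
  points on and off the union, with \<open>D\<close> possibly empty.\<close>

lemma segments_locally_conical:
  fixes p :: "'a::euclidean_space"
  assumes "finite S"
  obtains r D where "0 < r" "\<And>d. d \<in> D \<Longrightarrow> norm d = 1"
    "(\<Union>(a, b)\<in>S. closed_segment a b) \<inter> (ball p r - {p}) = (\<lambda>(d, s). p + s *\<^sub>R d) ` (D \<times> {0<..<r})"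
proof -
  define conical where "conical = (\<lambda>X r D. 0 < r \<and> (\<forall>d\<in>D. norm d = 1) \<and>
    X \<inter> (ball p r - {p}) = (\<lambda>(d, s). p + s *\<^sub>R d) ` (D \<times> {0<..<r}))"
  have shrink: "conical X r' D" if "conical X r D" "0 < r'" "r' \<le> r" for X r r' D
  proof -
    have "X \<inter> (ball p r' - {p}) = (X \<inter> (ball p r - {p})) \<inter> ball p r'"
      using that(3) by auto
    also have "\<dots> = (\<lambda>(d, s). p + s *\<^sub>R d) ` (D \<times> {0<..<r}) \<inter> ball p r'"
      using that(1) by (simp add: conical_def)
    also have "\<dots> = (\<lambda>(d, s). p + s *\<^sub>R d) ` (D \<times> {0<..<r'})"
      using that(1,3) by (force simp: conical_def dist_norm)
    finally show ?thesis using that by (auto simp: conical_def)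
  qed
  have union: "\<exists>r D. conical (X \<union> Y) r D" if "conical X r1 D1" "conical Y r2 D2" for X Y r1 D1 r2 D2
  proof -
    let ?r = "min r1 r2"
    have pos: "0 < ?r" using that by (simp add: conical_def)
    have "conical X ?r D1" "conical Y ?r D2" using that pos shrink by auto
    then have "conical (X \<union> Y) ?r (D1 \<union> D2)"
      unfolding conical_def by (simp add: Int_Un_distrib2 Sigma_Un_distrib1 image_Un) blast
    then show ?thesis by blast
  qed
  have spoke: "\<exists>r D. conical (closed_segment p a) r D" for a
  proof (cases "a = p")
    case True
    then have "conical (closed_segment p a) 1 {}" by (auto simp: conical_def)
    then show ?thesis by blast
  next
    case False
    let ?r = "norm (a - p)" and ?d = "sgn (a - p)"
    have "closed_segment p a \<inter> (ball p ?r - {p}) = (\<lambda>(d, s). p + s *\<^sub>R d) ` ({?d} \<times> {0<..<?r})" (is "?L = ?R")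
    proof (intro equalityI subsetI)
      fix x assume x: "x \<in> ?L"
      then obtain u where u: "0 \<le> u" "u \<le> 1" "x = p + u *\<^sub>R (a - p)"
        by (auto simp: closed_segment_def algebra_simps)
      then have "x = p + (u * ?r) *\<^sub>R ?d" using False by (simp add: sgn_div_norm)
      moreover have "u \<noteq> 0" "u < 1" using x u False by (auto simp: dist_norm)
      ultimately show "x \<in> ?R" using u False by (auto intro!: image_eqI[of _ _ "(?d, u * ?r)"])
    next
      fix x assume "x \<in> ?R"
      then obtain s where s: "0 < s" "s < ?r" "x = p + s *\<^sub>R ?d" by auto
      then have "x = p + (s / ?r) *\<^sub>R (a - p)" using False by (simp add: sgn_div_norm divide_inverse)
      then have "x = (1 - s / ?r) *\<^sub>R p + (s / ?r) *\<^sub>R a" by (simp add: algebra_simps)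
      then have "x \<in> closed_segment p a"
        unfolding closed_segment_def using s by (auto intro!: exI[of _ "s / ?r"] simp: divide_le_eq_1)
      moreover have "norm (x - p) = s" using s False by (simp add: norm_sgn)
      ultimately show "x \<in> ?L" using s by (auto simp: dist_norm norm_minus_commute)
    qed
    then have "conical (closed_segment p a) ?r {?d}" using False by (simp add: conical_def norm_sgn)
    then show ?thesis by blast
  qed
  have segment: "\<exists>r D. conical (closed_segment a b) r D" for a b
  proof (cases "p \<in> closed_segment a b")
    case True
    then have "closed_segment a b = closed_segment p a \<union> closed_segment p b"
      by (metis Un_closed_segment closed_segment_commute)
    then show ?thesis using spoke union by metis
  next
    case False
    then obtain r where "r > 0" "closed_segment a b \<inter> ball p r = {}"
      by (metis closed_segment closed_def openE ComplI disjoint_eq_subset_Compl inf_commute)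
    then have "conical (closed_segment a b) r {}" by (auto simp: conical_def)
    then show ?thesis by blast
  qed
  have "\<exists>r D. conical (\<Union>(a, b)\<in>S. closed_segment a b) r D"
    using assms
  proof induction
    case empty
    have "conical {} 1 {}" by (auto simp: conical_def)
    then show ?case by auto
  next
    case (insert ab S)
    then show ?case using segment[of "fst ab" "snd ab"] union by (auto simp: split_beta)
  qed
  then show ?thesis using that by (auto simp: conical_def)
qed

subsection \<open>Polygonal arcs are unknotted\<close>

text \<open>Both functions rise from the same value, so by the intermediate value theorem both
  attain the smaller of their values at \<open>r/2\<close>. Applied to two radii that leave the same
  point, it forces them to share a further point of the arc.\<close>

lemma strict_mono_images_overlap:
  fixes \<phi> \<psi> :: "real \<Rightarrow> real"
  assumes "0 < r" "continuous_on {0..<r} \<phi>" "continuous_on {0..<r} \<psi>" "\<phi> 0 = \<psi> 0"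
    "strict_mono_on {0..<r} \<phi>" "strict_mono_on {0..<r} \<psi>"
  obtains s s' where "s \<in> {0<..<r}" "s' \<in> {0<..<r}" "\<phi> s = \<psi> s'"
proof -
  define m where "m = min (\<phi> (r/2)) (\<psi> (r/2))"
  have m: "\<phi> 0 < m" "m \<le> \<phi> (r/2)" "m \<le> \<psi> (r/2)"
    using strict_mono_onD[OF assms(5), of 0 "r/2"] strict_mono_onD[OF assms(6), of 0 "r/2"] assms(1,4)
    by (auto simp: m_def)
  have "\<exists>s. 0 \<le> s \<and> s \<le> r/2 \<and> \<phi> s = m"
    by (rule IVT') (use m assms in \<open>auto elim: continuous_on_subset\<close>)
  moreover have "\<exists>s. 0 \<le> s \<and> s \<le> r/2 \<and> \<psi> s = m"
    by (rule IVT') (use m assms in \<open>auto elim: continuous_on_subset\<close>)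
  ultimately obtain s s' where "0 \<le> s" "s \<le> r/2" "\<phi> s = m" "0 \<le> s'" "s' \<le> r/2" "\<psi> s' = m" by blast
  moreover have "s \<noteq> 0" "s' \<noteq> 0" using calculation m assms by auto
  ultimately show ?thesis using assms(1) by (intro that[of s s']) auto
qed

text \<open>The cone condition concerns only the image, matching what tameness provides;
  \<open>g\<close> is not assumed to be piecewise linear as a map.\<close>

locale arc_with_conical_points =
  fixes g :: "real \<Rightarrow> 'a::euclidean_space"
  assumes arc: "arc g"
    and conical: "\<And>p. \<exists>r D. 0 < r \<and> (\<forall>d\<in>D. norm d = 1) \<and>
      path_image g \<inter> (ball p r - {p}) = (\<lambda>(d, s). p + s *\<^sub>R d) ` (D \<times> {0<..<r})"
begin

definition param :: "'a \<Rightarrow> real" where "param = the_inv_into {0..1} g"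

lemma g_continuous: "continuous_on {0..1} g"
  using arc by (simp add: arc_def path_def)

lemma g_inj: "inj_on g {0..1}"
  using arc by (simp add: arc_def)

lemma param_g [simp]: "x \<in> {0..1} \<Longrightarrow> param (g x) = x"
  using g_inj by (simp add: param_def the_inv_into_f_f)

lemma g_param [simp]: "x \<in> path_image g \<Longrightarrow> g (param x) = x"
  by (auto simp: path_image_def)

lemma param_range: "x \<in> path_image g \<Longrightarrow> param x \<in> {0..1}"
  by (auto simp: path_image_def)

lemma param_continuous: "continuous_on (path_image g) param"
  unfolding path_image_def
  by (rule continuous_on_inv) (auto intro: g_continuous)

lemma param_inj: "inj_on param (path_image g)"
  by (metis g_param inj_onI)

text \<open>Reading a radius in the arc parameter replaces geometry by a real function on an
  interval, to which monotonicity and intermediate values apply.\<close>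

definition spoke :: "real \<Rightarrow> 'a \<Rightarrow> real \<Rightarrow> real" where
  "spoke t d s = param (g t + s *\<^sub>R d)"

text \<open>Each radius of the arc at \<open>g t\<close> is traversed monotonically, so at most one radius arrives
  at \<open>g t\<close> and at most one leaves.\<close>

lemma spokes:
  assumes t: "t \<in> {0..1}" and r: "0 < r" and D: "\<forall>d\<in>D. norm d = 1"
    and con: "path_image g \<inter> (ball (g t) r - {g t}) = (\<lambda>(d, s). g t + s *\<^sub>R d) ` (D \<times> {0<..<r})"
  shows spoke_in: "\<And>d s. d \<in> D \<Longrightarrow> s \<in> {0..<r} \<Longrightarrow> g t + s *\<^sub>R d \<in> path_image g"
    and spoke_0: "\<And>d. spoke t d 0 = t"
    and spoke_cont: "\<And>d. d \<in> D \<Longrightarrow> continuous_on {0..<r} (spoke t d)"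
    and spoke_mono: "\<And>d. d \<in> D \<Longrightarrow> strict_mono_on {0..<r} (spoke t d) \<or> strict_antimono_on {0..<r} (spoke t d)"
    and spoke_unique_mono: "\<And>d d'. d \<in> D \<Longrightarrow> d' \<in> D \<Longrightarrow> strict_mono_on {0..<r} (spoke t d) \<Longrightarrow>
          strict_mono_on {0..<r} (spoke t d') \<Longrightarrow> d = d'"
    and spoke_unique_antimono: "\<And>d d'. d \<in> D \<Longrightarrow> d' \<in> D \<Longrightarrow> strict_antimono_on {0..<r} (spoke t d) \<Longrightarrow>
          strict_antimono_on {0..<r} (spoke t d') \<Longrightarrow> d = d'"
    and spoke_exists_mono: "t < 1 \<Longrightarrow> \<exists>d\<in>D. strict_mono_on {0..<r} (spoke t d)"
    and spoke_exists_antimono: "t > 0 \<Longrightarrow> \<exists>d\<in>D. strict_antimono_on {0..<r} (spoke t d)"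
proof -
  show in_image: "g t + s *\<^sub>R d \<in> path_image g" if "d \<in> D" "s \<in> {0..<r}" for d s
  proof (cases "s = 0")
    case True
    then show ?thesis using t by (simp add: path_image_def)
  next
    case False
    then have "g t + s *\<^sub>R d \<in> (\<lambda>(d, s). g t + s *\<^sub>R d) ` (D \<times> {0<..<r})" using that by auto
    then show ?thesis using con by blast
  qed
  show s0: "spoke t d 0 = t" for d using t by (simp add: spoke_def)
  show cont: "continuous_on {0..<r} (spoke t d)" if "d \<in> D" for d
    unfolding spoke_def
    by (rule continuous_on_compose2[OF param_continuous]) (auto intro!: continuous_intros in_image that)
  \<comment> \<open>Directions are unit vectors, so the norm recovers the distance \<open>s\<close>
    and then the direction: distinct radii meet only at the centre.\<close>
  have same: "d = d' \<and> s = s'"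
    if "d \<in> D" "d' \<in> D" "s \<in> {0<..<r}" "s' \<in> {0<..<r}" "spoke t d s = spoke t d' s'" for d d' s s'
  proof -
    have "g t + s *\<^sub>R d = g t + s' *\<^sub>R d'"
      by (rule inj_onD[OF param_inj]) (use that in_image in \<open>auto simp: spoke_def\<close>)
    then have eq: "s *\<^sub>R d = s' *\<^sub>R d'" by simp
    then have "norm (s *\<^sub>R d) = norm (s' *\<^sub>R d')" by simp
    then have "s = s'" using that D by simp
    then show ?thesis using eq that by simp
  qed
  have inj: "inj_on (spoke t d) {0..<r}" if "d \<in> D" for d
  proof (rule inj_onI)
    fix s s' assume s: "s \<in> {0..<r}" "s' \<in> {0..<r}" "spoke t d s = spoke t d s'"
    have "g t + s *\<^sub>R d = g t + s' *\<^sub>R d"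
      by (rule inj_onD[OF param_inj]) (use that in_image s in \<open>auto simp: spoke_def\<close>)
    then show "s = s'" using bspec[OF D that] by auto
  qed
  show mono: "strict_mono_on {0..<r} (spoke t d) \<or> strict_antimono_on {0..<r} (spoke t d)" if "d \<in> D" for d
    using injective_eq_monotone_map[of "{0..<r}" "spoke t d"] inj cont that
    by (simp add: is_interval_co)
  show "d = d'" if "d \<in> D" "d' \<in> D" "strict_mono_on {0..<r} (spoke t d)" "strict_mono_on {0..<r} (spoke t d')" for d d'
    using strict_mono_images_overlap[of r "spoke t d" "spoke t d'"] that r cont s0 same by metis
  show "d = d'" if "d \<in> D" "d' \<in> D" "strict_antimono_on {0..<r} (spoke t d)" "strict_antimono_on {0..<r} (spoke t d')" for d d'
  proof -
    have neg: "strict_mono_on {0..<r} (\<lambda>s. - spoke t d s)" "strict_mono_on {0..<r} (\<lambda>s. - spoke t d' s)"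
      using that by (simp_all add: monotone_on_def)
    have negc: "continuous_on {0..<r} (\<lambda>s. - spoke t d s)" "continuous_on {0..<r} (\<lambda>s. - spoke t d' s)"
      using that cont by (simp_all add: continuous_on_minus)
    obtain s s' where "s \<in> {0<..<r}" "s' \<in> {0<..<r}" "- spoke t d s = - spoke t d' s'"
      using strict_mono_images_overlap[OF r negc _ neg] s0 by metis
    then show ?thesis using same that by simp
  qed
  \<comment> \<open>By continuity of \<open>g\<close>, parameters close to \<open>t\<close> land in
    the ball and therefore on some radius.\<close>
  have near: "\<exists>\<delta>>0. \<forall>y\<in>{0..1}. y \<noteq> t \<and> \<bar>y - t\<bar> < \<delta> \<longrightarrow> (\<exists>d\<in>D. \<exists>s\<in>{0<..<r}. spoke t d s = y)"
  proof -
    obtain \<delta> where \<delta>: "\<delta> > 0" "\<And>y. y \<in> {0..1} \<Longrightarrow> dist y t < \<delta> \<Longrightarrow> dist (g y) (g t) < r"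
      using g_continuous t r unfolding continuous_on_iff by metis
    have "\<exists>d\<in>D. \<exists>s\<in>{0<..<r}. spoke t d s = y" if y: "y \<in> {0..1}" "y \<noteq> t" "\<bar>y - t\<bar> < \<delta>" for y
    proof -
      have "g y \<noteq> g t" using y t g_inj by (auto dest: inj_onD)
      moreover have "g y \<in> ball (g t) r" using \<delta>(2)[of y] y by (simp add: dist_real_def dist_commute)
      moreover have "g y \<in> path_image g" using y by (simp add: path_image_def)
      ultimately have "g y \<in> (\<lambda>(d, s). g t + s *\<^sub>R d) ` (D \<times> {0<..<r})" using con by blast
      then obtain d s where "d \<in> D" "s \<in> {0<..<r}" "g y = g t + s *\<^sub>R d" by auto
      then show ?thesis using y(1) by (metis param_g spoke_def)
    qed
    then show ?thesis using \<delta>(1) by blast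
  qed
  then obtain \<delta> where \<delta>: "\<delta> > 0"
    "\<And>y. y \<in> {0..1} \<Longrightarrow> y \<noteq> t \<Longrightarrow> \<bar>y - t\<bar> < \<delta> \<Longrightarrow> \<exists>d\<in>D. \<exists>s\<in>{0<..<r}. spoke t d s = y" by blast
  show "\<exists>d\<in>D. strict_mono_on {0..<r} (spoke t d)" if "t < 1"
  proof -
    \<comment> \<open>A parameter just above \<open>t\<close> lies on some radius. That radius
      starts at \<open>t\<close> and takes a larger value, so it cannot be decreasing.\<close>
    define y where "y = min 1 (t + \<delta>/2)"
    have "y \<in> {0..1}" "y > t" "\<bar>y - t\<bar> < \<delta>" using that t \<delta>(1) by (auto simp: y_def)
    then obtain d s where d: "d \<in> D" "s \<in> {0<..<r}" "spoke t d s > t" using \<delta>(2)[of y] by auto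
    then have "\<not> strict_antimono_on {0..<r} (spoke t d)"
      using monotone_onD[of "{0..<r}" "(<)" "(>)" "spoke t d" 0 s] s0[of d] by auto
    then show ?thesis using mono d by blast
  qed
  show "\<exists>d\<in>D. strict_antimono_on {0..<r} (spoke t d)" if "t > 0"
  proof -
    define y where "y = max 0 (t - \<delta>/2)"
    have "y \<in> {0..1}" "y < t" "\<bar>y - t\<bar> < \<delta>" using that t \<delta>(1) by (auto simp: y_def)
    then obtain d s where d: "d \<in> D" "s \<in> {0<..<r}" "spoke t d s < t" using \<delta>(2)[of y] by auto
    then have "\<not> strict_mono_on {0..<r} (spoke t d)"
      using monotone_onD[of "{0..<r}" "(<)" "(<)" "spoke t d" 0 s] s0[of d] by auto
    then show ?thesis using mono d by blast
  qed
qed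

text \<open>An increasing radius at \<open>g 0\<close> sweeps out, by intermediate values, every
  parameter from 0 up to its value at \<open>r/2\<close>. The corresponding piece of the arc is thus
  half of that radius. Stopping at \<open>r/2\<close> keeps the endpoint inside the open
  ball.\<close>

lemma initial_segment:
  obtains s where "s \<in> {0<..1}" "g ` {0..s} = closed_segment (g 0) (g s)"
proof -
  obtain r D where r: "0 < r" and D: "\<forall>d\<in>D. norm d = 1"
    and con: "path_image g \<inter> (ball (g 0) r - {g 0}) = (\<lambda>(d, s). g 0 + s *\<^sub>R d) ` (D \<times> {0<..<r})"
    using conical[of "g 0"] by metis
  have 0: "0 \<in> {0..1::real}" by simp
  note sp = spokes[OF 0 r D con]
  obtain d where d: "d \<in> D" "strict_mono_on {0..<r} (spoke 0 d)" using sp(7) by auto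
  define s where "s = spoke 0 d (r/2)"
  have gs: "g (spoke 0 d u) = g 0 + u *\<^sub>R d" if "u \<in> {0..<r}" for u
    using sp(1)[OF d(1) that] by (simp add: spoke_def)
  have "spoke 0 d ` {0..r/2} = {0..s}"
  proof (intro equalityI subsetI)
    fix y assume "y \<in> spoke 0 d ` {0..r/2}"
    then obtain u where u: "u \<in> {0..r/2}" "y = spoke 0 d u" by auto
    then have "spoke 0 d 0 \<le> y" "y \<le> s"
      using d(2) r unfolding s_def by (auto intro!: strict_mono_on_leD[OF d(2)])
    then show "y \<in> {0..s}" by (simp add: sp(2))
  next
    fix y assume "y \<in> {0..s}"
    then have "\<exists>u. 0 \<le> u \<and> u \<le> r/2 \<and> spoke 0 d u = y"
      by (intro IVT') (use r sp(3)[OF d(1)] in \<open>auto simp: sp(2) s_def elim: continuous_on_subset\<close>)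
    then show "y \<in> spoke 0 d ` {0..r/2}" by auto
  qed
  then have "g ` {0..s} = (\<lambda>u. g (spoke 0 d u)) ` {0..r/2}"
    by (metis image_image)
  also have "\<dots> = (\<lambda>u. g 0 + u *\<^sub>R d) ` {0..r/2}"
    using r by (intro image_cong refl gs) auto
  also have "\<dots> = closed_segment (g 0) (g 0 + (r/2) *\<^sub>R d)"
  proof -
    have "(\<lambda>u. (r/2) * u) ` {0..1} = {0..r/2}"
      using r by (subst image_mult_atLeastAtMost) auto
    then have "(\<lambda>u. g 0 + u *\<^sub>R d) ` {0..r/2} = (\<lambda>u. g 0 + u *\<^sub>R d) ` ((\<lambda>u. (r/2) * u) ` {0..1})"
      by simp
    also have "\<dots> = closed_segment (g 0) (g 0 + (r/2) *\<^sub>R d)"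
      unfolding closed_segment_image_interval image_image
      by (rule image_cong) (auto simp: algebra_simps)
    finally show ?thesis .
  qed
  also have "g 0 + (r/2) *\<^sub>R d = g s" using gs[of "r/2"] r by (simp add: s_def)
  finally have "g ` {0..s} = closed_segment (g 0) (g s)" .
  moreover have "spoke 0 d 0 < s" unfolding s_def using r by (intro strict_mono_onD[OF d(2)]) auto
  moreover have "s \<le> 1" using param_range[OF sp(1)[OF d(1), of "r/2"]] r by (simp add: s_def spoke_def)
  ultimately show ?thesis using that[of s] sp(2) by auto
qed

section \<open>Charts in which the arc is straight\<close>

text \<open>The counterpart of \<open>spoke\<close> after straightening: a single function now
  covers both sides of the point.\<close>

definition line_param :: "('a \<Rightarrow> 'a) \<Rightarrow> 'a \<Rightarrow> real \<Rightarrow> real" where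
  "line_param \<sigma> e s = param (inv_into UNIV \<sigma> (s *\<^sub>R e))"

lemma
  assumes \<sigma>: "self_homeomorphism \<sigma>" and sub: "(\<lambda>s. s *\<^sub>R e) ` J \<subseteq> \<sigma> ` path_image g" 
  shows g_line_param: "\<And>s. s \<in> J \<Longrightarrow> \<sigma> (g (line_param \<sigma> e s)) = s *\<^sub>R e"
    and line_param_range: "\<And>s. s \<in> J \<Longrightarrow> line_param \<sigma> e s \<in> {0..1}"
    and line_param_continuous: "continuous_on J (line_param \<sigma> e)"
    and line_param_monotone: "is_interval J \<Longrightarrow> norm e = 1 \<Longrightarrow>
      strict_mono_on J (line_param \<sigma> e) \<or> strict_antimono_on J (line_param \<sigma> e)"
proof -
  have bij: "bij \<sigma>" using \<sigma> by (rule self_homeomorphism_bij)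
  have in_arc: "inv_into UNIV \<sigma> (s *\<^sub>R e) \<in> path_image g" if s: "s \<in> J" for s
  proof -
    obtain x where "x \<in> path_image g" "s *\<^sub>R e = \<sigma> x" using sub s by blast
    then show ?thesis using bij by (simp add: bij_is_inj inv_f_f)
  qed
  show eq: "\<sigma> (g (line_param \<sigma> e s)) = s *\<^sub>R e" if "s \<in> J" for s
    using in_arc[OF that] bij by (simp add: line_param_def bij_is_surj surj_f_inv_f)
  show "line_param \<sigma> e s \<in> {0..1}" if "s \<in> J" for s
    using param_range[OF in_arc[OF that]] by (simp add: line_param_def)
  show cont: "continuous_on J (line_param \<sigma> e)"
    unfolding line_param_def
    by (rule continuous_on_compose2[OF param_continuous])
      (auto intro!: continuous_on_compose2[OF self_homeomorphism_continuous[OF self_homeomorphism_inv[OF \<sigma>]]]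
         continuous_intros in_arc)
  show "strict_mono_on J (line_param \<sigma> e) \<or> strict_antimono_on J (line_param \<sigma> e)"
    if J: "is_interval J" and e: "norm e = 1"
  proof -
    have "inj_on (line_param \<sigma> e) J"
    proof (rule inj_onI)
      fix s s' assume "s \<in> J" "s' \<in> J" "line_param \<sigma> e s = line_param \<sigma> e s'"
      then have "s *\<^sub>R e = s' *\<^sub>R e" using eq by metis
      then show "s = s'" using e by auto
    qed
    then show ?thesis using injective_eq_monotone_map[OF J cont] by blast
  qed
qed

text \<open>The interval \<open>J\<close> is left variable so that one notion covers interior
  points, with \<open>J = {-\<eta><..<\<eta>}\<close>, and the terminal end, with
  \<open>J = {-\<eta><..0}\<close>. Monotonicity fixes the sign of \<open>e\<close>: the arc arrives
  from the negative side, as \<open>push_along_line\<close> expects.\<close>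

definition straight_chart :: "real \<Rightarrow> ('a \<Rightarrow> 'a) \<Rightarrow> 'a \<Rightarrow> real \<Rightarrow> real set \<Rightarrow> bool" where
  "straight_chart t \<sigma> e \<eta> J \<longleftrightarrow>
     self_homeomorphism \<sigma> \<and> norm e = 1 \<and> 0 < \<eta> \<and> \<sigma> (g t) = 0 \<and>
     {-\<eta><..0} \<subseteq> J \<and> J \<subseteq> {-\<eta><..<\<eta>} \<and> is_interval J \<and>
     \<sigma> ` path_image g \<inter> ball 0 \<eta> = (\<lambda>s. s *\<^sub>R e) ` J \<and> strict_mono_on J (line_param \<sigma> e)"

text \<open>No radius at \<open>g 1\<close> can increase, since parameters stop at 1, so there is
  just one and a translation already straightens it. The axis is \<open>-d\<close>, pointing away
  from the arc; a decreasing \<open>line_param\<close> would again exceed its value 1 at the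
  end.\<close>

lemma straight_chart_exists_at_end:
  "\<exists>\<sigma> e \<eta> J. straight_chart 1 \<sigma> e \<eta> J"
proof -
  obtain r D where r: "0 < r" and D: "\<forall>d\<in>D. norm d = 1"
    and con: "path_image g \<inter> (ball (g 1) r - {g 1}) = (\<lambda>(d, s). g 1 + s *\<^sub>R d) ` (D \<times> {0<..<r})"
    using conical[of "g 1"] by metis
  have 1: "1 \<in> {0..1::real}" by simp
  note sp = spokes[OF 1 r D con]
  obtain d where d: "d \<in> D" "strict_antimono_on {0..<r} (spoke 1 d)" using sp(8) by auto
  have "d' = d" if d': "d' \<in> D" for d'
  proof -
    have "spoke 1 d' (r/2) \<le> 1"
      using param_range[OF sp(1)[OF d', of "r/2"]] r by (simp add: spoke_def)
    then have "\<not> strict_mono_on {0..<r} (spoke 1 d')"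
      using strict_mono_onD[of "{0..<r}" "spoke 1 d'" 0 "r/2"] sp(2)[of d'] r by auto
    then show ?thesis using sp(4,6) d d' by blast
  qed
  then have D': "D = {d}" using d by blast
  define \<sigma> where "\<sigma> = (\<lambda>x::'a. x - g 1)"
  have \<sigma>: "self_homeomorphism \<sigma>" unfolding \<sigma>_def by (rule self_homeomorphism_translation)
  have nd: "norm (-d) = 1" using D d by simp
  have im: "\<sigma> ` path_image g \<inter> ball 0 r = (\<lambda>s. s *\<^sub>R (-d)) ` {-r<..0}" (is "?L = ?R")
  proof (intro equalityI subsetI)
    fix y assume "y \<in> ?L"
    then obtain x where x: "x \<in> path_image g" "y = x - g 1" "norm (x - g 1) < r" by (auto simp: \<sigma>_def)
    show "y \<in> ?R"
    proof (cases "x = g 1")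
      case True
      then show ?thesis using x r by (auto intro!: image_eqI[of _ _ 0])
    next
      case False
      then have "x \<in> path_image g \<inter> (ball (g 1) r - {g 1})"
        using x by (auto simp: dist_norm norm_minus_commute)
      then obtain s where "s \<in> {0<..<r}" "x = g 1 + s *\<^sub>R d" using con D' by auto
      then show ?thesis using x by (intro image_eqI[of _ _ "-s"]) auto
    qed
  next
    fix y assume "y \<in> ?R"
    then obtain s where s: "s \<in> {-r<..0}" "y = (-s) *\<^sub>R d" by auto
    then have "y + g 1 \<in> path_image g" using sp(1)[OF d(1), of "-s"] by (simp add: add.commute)
    moreover have "norm y < r" using s nd by simp
    ultimately show "y \<in> ?L" by (auto simp: \<sigma>_def intro!: image_eqI[of _ _ "y + g 1"])
  qed
  have int: "is_interval {-r<..0}" by (simp add: is_interval_oc)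
  have sub: "(\<lambda>s. s *\<^sub>R (-d)) ` {-r<..0} \<subseteq> \<sigma> ` path_image g" using im by blast
  have "\<not> strict_antimono_on {-r<..0} (line_param \<sigma> (-d))"
  proof
    assume "strict_antimono_on {-r<..0} (line_param \<sigma> (-d))"
    then have "line_param \<sigma> (-d) (-r/2) > line_param \<sigma> (-d) 0"
      using monotone_onD[of "{-r<..0}" "(<)" "(>)" "line_param \<sigma> (-d)" "-r/2" 0] r by auto
    moreover have "inv_into UNIV \<sigma> 0 = g 1"
      using self_homeomorphism_bij[OF \<sigma>] by (intro inv_into_f_eq) (auto simp: \<sigma>_def bij_def)
    then have "line_param \<sigma> (-d) 0 = 1" by (simp add: line_param_def)
    moreover have "line_param \<sigma> (-d) (-r/2) \<le> 1"
      using line_param_range[OF \<sigma> sub, of "-r/2"] r by auto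
    ultimately show False by simp
  qed
  then have "strict_mono_on {-r<..0} (line_param \<sigma> (-d))"
    using line_param_monotone[OF \<sigma> sub int nd] by blast
  then have "straight_chart 1 \<sigma> (-d) r {-r<..0}"
    unfolding straight_chart_def using \<sigma> nd r im int by (auto simp: \<sigma>_def)
  then show ?thesis by blast
qed

text \<open>One radius arrives and one leaves, and there is no third. They differ because the
  parameter falls along one and rises along the other, so they form a corner that the shear
  straightens.\<close>

lemma straight_chart_exists_inside:
  assumes t: "0 < t" "t < 1"
  shows "\<exists>\<sigma> e \<eta> J. straight_chart t \<sigma> e \<eta> J"
proof -
  obtain r D where r: "0 < r" and D: "\<forall>d\<in>D. norm d = 1"
    and con: "path_image g \<inter> (ball (g t) r - {g t}) = (\<lambda>(d, s). g t + s *\<^sub>R d) ` (D \<times> {0<..<r})"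
    using conical[of "g t"] by metis
  have t': "t \<in> {0..1::real}" using t by simp
  note sp = spokes[OF t' r D con]
  obtain a where a: "a \<in> D" "strict_antimono_on {0..<r} (spoke t a)" using sp(8) t by auto
  obtain b where b: "b \<in> D" "strict_mono_on {0..<r} (spoke t b)" using sp(7) t by auto
  have D': "D = {a, b}" using sp(4,5,6) a b by blast
  have "spoke t a (r/2) < spoke t a 0" "spoke t b 0 < spoke t b (r/2)"
    using monotone_onD[OF a(2), of 0 "r/2"] monotone_onD[OF b(2), of 0 "r/2"] r by auto
  then have "a \<noteq> b" using sp(2) by auto
  then obtain \<sigma>0 e \<eta> where \<sigma>0: "self_homeomorphism \<sigma>0" "norm e = 1" "0 < \<eta>" "\<sigma>0 0 = 0"
    "ball 0 \<eta> \<subseteq> \<sigma>0 ` ball 0 r"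
    "\<sigma>0 ` (\<lambda>(d, s). s *\<^sub>R d) ` ({a, b} \<times> {0..<r}) \<inter> ball 0 \<eta> = (\<lambda>s. s *\<^sub>R e) ` {-\<eta><..<\<eta>}"
    using straighten_corner[of a b r] D a b r by metis
  define \<sigma> where "\<sigma> = \<sigma>0 \<circ> (\<lambda>x. x - g t)"
  have \<sigma>: "self_homeomorphism \<sigma>"
    unfolding \<sigma>_def by (intro self_homeomorphism_compose self_homeomorphism_translation \<sigma>0)
  let ?A = "(\<lambda>x. x - g t) ` path_image g"
  have A: "?A \<inter> ball 0 r = (\<lambda>(d, s). s *\<^sub>R d) ` ({a, b} \<times> {0..<r})" (is "?L = ?R")
  proof (intro equalityI subsetI)
    fix y assume "y \<in> ?L"
    then obtain x where x: "x \<in> path_image g" "y = x - g t" "norm (x - g t) < r" by auto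
    show "y \<in> ?R"
    proof (cases "x = g t")
      case True
      then show ?thesis using x r by (auto intro!: image_eqI[of _ _ "(a, 0)"])
    next
      case False
      then have "x \<in> path_image g \<inter> (ball (g t) r - {g t})"
        using x by (auto simp: dist_norm norm_minus_commute)
      then obtain q where "q \<in> D \<times> {0<..<r}" "x = (case q of (d, s) \<Rightarrow> g t + s *\<^sub>R d)"
        using con by blast
      then show ?thesis using x D' by (intro image_eqI[of _ _ q]) (auto split: prod.splits)
    qed
  next
    fix y assume "y \<in> ?R"
    then obtain q where "q \<in> {a, b} \<times> {0..<r}" "y = (case q of (d, s) \<Rightarrow> s *\<^sub>R d)" by blast
    then obtain d s where s: "d \<in> D" "s \<in> {0..<r}" "y = s *\<^sub>R d" using D' by (cases q) auto
    then have "y + g t \<in> path_image g" using sp(1)[OF s(1,2)] by (simp add: add.commute)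
    moreover have "norm y < r" using s D by simp
    ultimately show "y \<in> ?L" by (auto intro!: image_eqI[of _ _ "y + g t"])
  qed
  \<comment> \<open>The small ball lies in the image of \<open>ball 0 r\<close> and the shear is
    injective, so only the conical part of the arc shows up in it.\<close>
  have "\<sigma> ` path_image g \<inter> ball 0 \<eta> = \<sigma>0 ` ?A \<inter> \<sigma>0 ` ball 0 r \<inter> ball 0 \<eta>"
    using \<sigma>0(5) by (auto simp: \<sigma>_def image_comp)
  also have "\<sigma>0 ` ?A \<inter> \<sigma>0 ` ball 0 r = \<sigma>0 ` (?A \<inter> ball 0 r)"
    using self_homeomorphism_bij[OF \<sigma>0(1)] by (simp add: bij_is_inj image_Int)
  finally have im: "\<sigma> ` path_image g \<inter> ball 0 \<eta> = (\<lambda>s. s *\<^sub>R e) ` {-\<eta><..<\<eta>}"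
    unfolding A using \<sigma>0(6) by simp
  have int: "is_interval {-\<eta><..<\<eta>}" by (simp add: is_interval_oo)
  have sub: "(\<lambda>s. s *\<^sub>R e) ` {-\<eta><..<\<eta>} \<subseteq> \<sigma> ` path_image g" using im by blast
  have \<sigma>t: "\<sigma> (g t) = 0" using \<sigma>0 by (simp add: \<sigma>_def)
  consider "strict_mono_on {-\<eta><..<\<eta>} (line_param \<sigma> e)" | "strict_antimono_on {-\<eta><..<\<eta>} (line_param \<sigma> e)"
    using line_param_monotone[OF \<sigma> sub int \<sigma>0(2)] by blast
  then show ?thesis
  proof cases
    case 1
    then have "straight_chart t \<sigma> e \<eta> {-\<eta><..<\<eta>}"
      unfolding straight_chart_def using \<sigma> \<sigma>0 im int \<sigma>t by auto
    then show ?thesis by blast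
  next
    case 2
    \<comment> \<open>The interval is symmetric, so replacing \<open>e\<close> by \<open>-e\<close>
      keeps the strand and reverses its direction.\<close>
    have "(\<lambda>s. s *\<^sub>R e) ` {-\<eta><..<\<eta>} = (\<lambda>s. s *\<^sub>R (-e)) ` (uminus :: real \<Rightarrow> real) ` {-\<eta><..<\<eta>}"
      unfolding image_image by simp
    also have "(uminus :: real \<Rightarrow> real) ` {-\<eta><..<\<eta>} = {-\<eta><..<\<eta>}" by simp
    finally have im': "\<sigma> ` path_image g \<inter> ball 0 \<eta> = (\<lambda>s. s *\<^sub>R (-e)) ` {-\<eta><..<\<eta>}" using im by simp
    have "strict_mono_on {-\<eta><..<\<eta>} (line_param \<sigma> (-e))"
    proof (rule strict_mono_onI)
      fix u v assume "u \<in> {-\<eta><..<\<eta>}" "v \<in> {-\<eta><..<\<eta>}" "u < v"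
      then have "line_param \<sigma> e (-u) < line_param \<sigma> e (-v)"
        using monotone_onD[OF 2, of "-v" "-u"] by auto
      then show "line_param \<sigma> (-e) u < line_param \<sigma> (-e) v" by (simp add: line_param_def)
    qed
    then have "straight_chart t \<sigma> (-e) \<eta> {-\<eta><..<\<eta>}"
      unfolding straight_chart_def using \<sigma> \<sigma>0 im' int \<sigma>t by auto
    then show ?thesis by blast
  qed
qed

section \<open>Sliding the free end along the arc\<close>

text \<open>Pieces are matched as sets together with their two endpoints, not point by point along
  \<open>g\<close>. That is enough for the final flip, which must preserve the image and exchange
  the ends.\<close>

definition equivalent_initial_arcs :: "real \<Rightarrow> real \<Rightarrow> bool" where
  "equivalent_initial_arcs s t \<longleftrightarrow>
     (\<exists>H. self_homeomorphism H \<and> H ` g ` {0..s} = g ` {0..t} \<and> H (g 0) = g 0 \<and> H (g s) = g t)"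

lemma equivalent_initial_arcs_sym:
  assumes "equivalent_initial_arcs s t" shows "equivalent_initial_arcs t s"
proof -
  obtain H where H: "self_homeomorphism H" "H ` g ` {0..s} = g ` {0..t}" "H (g 0) = g 0" "H (g s) = g t"
    using assms equivalent_initial_arcs_def by blast
  have inj: "inj H" using self_homeomorphism_bij[OF H(1)] bij_is_inj by blast
  have "inv_into UNIV H ` g ` {0..t} = g ` {0..s}"
    unfolding H(2)[symmetric] using inj by (simp add: image_image)
  moreover have "inv_into UNIV H (g 0) = g 0" "inv_into UNIV H (g t) = g s"
    using inj H by (metis inv_f_f)+
  ultimately show ?thesis
    using self_homeomorphism_inv[OF H(1)] equivalent_initial_arcs_def by blast
qed

lemma equivalent_initial_arcs_trans:
  assumes "equivalent_initial_arcs s t" "equivalent_initial_arcs t u"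
  shows "equivalent_initial_arcs s u"
proof -
  obtain H where H: "self_homeomorphism H" "H ` g ` {0..s} = g ` {0..t}" "H (g 0) = g 0" "H (g s) = g t"
    using assms equivalent_initial_arcs_def by blast
  obtain K where K: "self_homeomorphism K" "K ` g ` {0..t} = g ` {0..u}" "K (g 0) = g 0" "K (g t) = g u"
    using assms equivalent_initial_arcs_def by blast
  have "(K \<circ> H) ` g ` {0..s} = g ` {0..u}" using H K by (metis image_comp)
  then show ?thesis
    unfolding equivalent_initial_arcs_def using self_homeomorphism_compose[OF H(1) K(1)] H K
    by (intro exI[of _ "K \<circ> H"]) simp
qed

text \<open>The sliding homeomorphism moves only the ball of the chart.  Inside it both pieces of the arc
  run along the \<open>e\<close>-axis from the boundary to their free ends; outside it they agree.\<close>

lemma slide_endpoint: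
  assumes chart: "straight_chart t \<sigma> e \<eta> J" and t: "t \<in> {0..1}"
    and x: "x \<in> {0..1}" "\<sigma> (g x) \<in> ball 0 \<eta>"
  shows "equivalent_initial_arcs t x"
proof -
  have \<sigma>: "self_homeomorphism \<sigma>" and e: "norm e = 1" and \<eta>: "0 < \<eta>" and \<sigma>t: "\<sigma> (g t) = 0"
    and J: "{-\<eta><..0} \<subseteq> J" "J \<subseteq> {-\<eta><..<\<eta>}" "is_interval J"
    and im: "\<sigma> ` path_image g \<inter> ball 0 \<eta> = (\<lambda>s. s *\<^sub>R e) ` J"
    and mono: "strict_mono_on J (line_param \<sigma> e)"
    using chart by (auto simp: straight_chart_def)
  define z where "z = line_param \<sigma> e"
  have sub: "(\<lambda>s. s *\<^sub>R e) ` J \<subseteq> \<sigma> ` path_image g" using im by blast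
  have inj: "inj \<sigma>" and surj: "surj \<sigma>" using self_homeomorphism_bij[OF \<sigma>] by (auto simp: bij_def)
  have gz: "\<sigma> (g (z s)) = s *\<^sub>R e" "z s \<in> {0..1}" if "s \<in> J" for s
    using g_line_param[OF \<sigma> sub that] line_param_range[OF \<sigma> sub that] by (auto simp: z_def)
  have in_ball: "\<exists>s\<in>J. y = z s \<and> \<sigma> (g y) = s *\<^sub>R e" if "y \<in> {0..1}" "\<sigma> (g y) \<in> ball 0 \<eta>" for y
  proof -
    have "\<sigma> (g y) \<in> \<sigma> ` path_image g \<inter> ball 0 \<eta>" using that by (auto simp: path_image_def)
    then obtain s where s: "s \<in> J" "\<sigma> (g y) = s *\<^sub>R e" using im by auto
    then have "\<sigma> (g y) = \<sigma> (g (z s))" using gz by simp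
    then have "g y = g (z s)" using inj by (auto dest: injD)
    then have "y = z s" using g_inj that gz(2)[OF s(1)] by (auto dest: inj_onD)
    then show ?thesis using s by blast
  qed
  have ball: "s *\<^sub>R e \<in> ball 0 \<eta>" if "s \<in> J" for s
  proof -
    have "s \<in> {-\<eta><..<\<eta>}" using J that by blast
    then show ?thesis using e by auto
  qed
  define B where "B = (\<lambda>y. \<sigma> ` g ` {0..y})"
  \<comment> \<open>\<open>J\<close> is closed downwards within the ball: below 0 by the chart,
    above 0 because it is an interval containing 0.\<close>
  have down: "v \<in> J" if "u \<in> J" "- \<eta> < v" "v \<le> u" for u v
  proof (cases "v \<le> 0")
    case True
    then show ?thesis using J that by auto
  next
    case False
    then have "0 \<in> J" "0 \<le> v" using J \<eta> by auto
    then show ?thesis using J(3) that unfolding is_interval_1 by blast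
  qed
  have B_in: "B (z u) \<inter> ball 0 \<eta> = (\<lambda>s. s *\<^sub>R e) ` {-\<eta><..u}" if u: "u \<in> J" for u
  proof (intro equalityI subsetI)
    fix w assume w: "w \<in> B (z u) \<inter> ball 0 \<eta>"
    then obtain y where y: "0 \<le> y" "y \<le> z u" "w = \<sigma> (g y)" by (auto simp: B_def)
    then obtain v where v: "v \<in> J" "y = z v" "w = v *\<^sub>R e"
      using in_ball[of y] gz(2)[OF u] w by auto
    have "\<not> u < v"
      using strict_mono_onD[OF mono u v(1)] y v by (auto simp: z_def)
    then show "w \<in> (\<lambda>s. s *\<^sub>R e) ` {-\<eta><..u}" using v J by (intro image_eqI[of _ _ v]) auto
  next
    fix w assume "w \<in> (\<lambda>s. s *\<^sub>R e) ` {-\<eta><..u}"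
    then obtain v where v: "- \<eta> < v" "v \<le> u" "w = v *\<^sub>R e" by auto
    then have vJ: "v \<in> J" using down u by blast
    have "z v \<le> z u" using strict_mono_on_leD[OF mono vJ u v(2)] by (simp add: z_def)
    then have "w \<in> B (z u)"
      unfolding B_def using gz[OF vJ] v by (auto intro!: image_eqI[of _ _ "z v"] image_eqI[of _ _ "g (z v)"])
    then show "w \<in> B (z u) \<inter> ball 0 \<eta>" using ball[OF vJ] v by simp
  qed
  \<comment> \<open>All parameters between \<open>z u'\<close> and \<open>z u\<close> are attained
    by \<open>z\<close> on the chart, by intermediate values. A point outside the ball therefore has
    its parameter below both or above both, so the two pieces agree there.\<close>
  have outside: "y \<le> z u'" if u: "u \<in> J" "u' \<in> J" "y \<le> z u" "\<sigma> (g y) \<notin> ball 0 \<eta>" for u u' y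
  proof (rule ccontr)
    assume "\<not> y \<le> z u'"
    then have lt: "z u' < y" by simp
    have "u' \<le> u"
    proof (rule ccontr)
      assume "\<not> u' \<le> u"
      then show False using strict_mono_onD[OF mono u(1,2)] lt u(3) by (auto simp: z_def)
    qed
    moreover have "{u'..u} \<subseteq> J"
      using J(3) u(1,2) unfolding is_interval_1 atLeastAtMost_iff subset_iff by blast
    then have "continuous_on {u'..u} z"
      unfolding z_def using line_param_continuous[OF \<sigma> sub] continuous_on_subset by blast
    ultimately have "\<exists>v. u' \<le> v \<and> v \<le> u \<and> z v = y"
      using lt u(3) by (intro IVT') auto
    then obtain v where "v \<in> J" "z v = y" using \<open>{u'..u} \<subseteq> J\<close> by auto
    then show False using gz(1) ball u(4) by metis
  qed
  have B_out: "B (z u) - ball 0 \<eta> = B (z u') - ball 0 \<eta>" if "u \<in> J" "u' \<in> J" for u u'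
  proof (intro equalityI subsetI)
    fix w assume "w \<in> B (z u) - ball 0 \<eta>"
    then obtain y where "0 \<le> y" "y \<le> z u" "w = \<sigma> (g y)" "w \<notin> ball 0 \<eta>" by (auto simp: B_def)
    then show "w \<in> B (z u') - ball 0 \<eta>" using outside[of u u' y] that by (auto simp: B_def)
  next
    fix w assume "w \<in> B (z u') - ball 0 \<eta>"
    then obtain y where "0 \<le> y" "y \<le> z u'" "w = \<sigma> (g y)" "w \<notin> ball 0 \<eta>" by (auto simp: B_def)
    then show "w \<in> B (z u) - ball 0 \<eta>" using outside[of u' u y] that by (auto simp: B_def)
  qed
  obtain s where s: "s \<in> J" "x = z s" "\<sigma> (g x) = s *\<^sub>R e" using in_ball[OF x] by blast
  have 0: "0 \<in> J" using J \<eta> by auto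
  have t0: "t = z 0" using in_ball[OF t] \<sigma>t \<eta> e by auto
  have "s \<in> {-\<eta><..<\<eta>}" using s(1) J(2) by blast
  then have "\<bar>s\<bar> < \<eta>" by auto
  then obtain f where f: "self_homeomorphism f" "\<And>x. x \<notin> ball 0 \<eta> \<Longrightarrow> f x = x" "f 0 = s *\<^sub>R e"
    "f ` ((\<lambda>t. t *\<^sub>R e) ` {-\<eta><..0}) = (\<lambda>t. t *\<^sub>R e) ` {-\<eta><..s}"
    using push_along_line[OF e \<eta>] by metis
  have split: "X = (X \<inter> ball 0 \<eta>) \<union> (X - ball 0 \<eta>)" for X :: "'a set" by blast
  have "f ` B t = f ` (B t \<inter> ball 0 \<eta>) \<union> f ` (B t - ball 0 \<eta>)"
    by (metis split image_Un)
  also have "f ` (B t - ball 0 \<eta>) = B t - ball 0 \<eta>" using f(2) by force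
  also have "\<dots> = B x - ball 0 \<eta>" using B_out[OF 0 s(1)] t0 s by simp
  also have "f ` (B t \<inter> ball 0 \<eta>) = B x \<inter> ball 0 \<eta>"
    using B_in[OF 0] B_in[OF s(1)] f(4) t0 s by simp
  finally have fB: "f ` B t = B x" using split by metis
  \<comment> \<open>The push is carried back through the chart by conjugation.\<close>
  define H where "H = inv_into UNIV \<sigma> \<circ> f \<circ> \<sigma>"
  have H: "self_homeomorphism H"
    unfolding H_def comp_assoc by (intro self_homeomorphism_compose self_homeomorphism_inv \<sigma> f)
  have "H ` g ` {0..t} = inv_into UNIV \<sigma> ` f ` B t"
    by (simp add: H_def B_def image_comp comp_assoc)
  also have "\<dots> = g ` {0..x}"
    unfolding fB unfolding B_def using inj by (simp add: image_image)
  finally have "H ` g ` {0..t} = g ` {0..x}" .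
  moreover have "f (\<sigma> (g t)) = \<sigma> (g x)" by (simp add: \<sigma>t f(3) s(3))
  then have "H (g t) = g x" using inj by (simp add: H_def)
  moreover have "\<sigma> (g 0) \<notin> ball 0 \<eta>"
  proof
    assume "\<sigma> (g 0) \<in> ball 0 \<eta>"
    then obtain u where u: "u \<in> J" "z u = 0" using in_ball[of 0] by auto
    \<comment> \<open>The starting point cannot lie in the chart: the midpoint of
      \<open>-\<eta>\<close> and \<open>u\<close> would still belong to \<open>J\<close> and have a
      negative parameter. Hence the slide fixes \<open>g 0\<close>.\<close>
    define v where "v = (u - \<eta>) / 2"
    have v: "- \<eta> < v" "v < u" using u J by (auto simp: v_def)
    then have "v \<in> J" using down u by auto
    then show False
      using strict_mono_onD[OF mono _ u(1) v(2)] u(2) gz(2)[of v] by (auto simp: z_def)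
  qed
  then have "H (g 0) = g 0" using f(2) inj by (simp add: H_def)
  ultimately show ?thesis using H equivalent_initial_arcs_def by blast
qed

text \<open>Charts make the equivalence classes of initial pieces relatively open in the connected
  set \<open>{0<..1}\<close>, so there is only one class, and it contains the short straight piece.
  The parameter 0 is left out because the piece degenerates to a point there.\<close>

lemma unknotting_homeomorphism:
  obtains H b where "self_homeomorphism H" "b \<noteq> g 0" "H ` path_image g = closed_segment (g 0) b"
    "H (g 0) = g 0" "H (g 1) = b"
proof -
  obtain s where s: "s \<in> {0<..1}" "g ` {0..s} = closed_segment (g 0) (g s)"
    by (rule initial_segment)
  have "equivalent_initial_arcs 1 s"
  proof (rule connected_equivalence_relation[of "{0<..1::real}"])
    show "connected {0<..1::real}" by simp
    show "\<exists>T. openin (top_of_set {0<..1}) T \<and> t \<in> T \<and> (\<forall>x\<in>T. equivalent_initial_arcs t x)"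
      if t: "t \<in> {0<..1}" for t
    proof -
      obtain \<sigma> e \<eta> J where chart: "straight_chart t \<sigma> e \<eta> J"
        using straight_chart_exists_at_end straight_chart_exists_inside[of t] t
        by (metis greaterThanAtMost_iff order_less_le)
      have "continuous_on {0<..1} (\<lambda>x. \<sigma> (g x))"
        using chart unfolding straight_chart_def
        by (auto intro!: continuous_on_compose2[OF self_homeomorphism_continuous[of \<sigma> UNIV]]
            intro: continuous_on_subset[OF g_continuous])
      then have "openin (top_of_set {0<..1}) ({0<..1} \<inter> (\<lambda>x. \<sigma> (g x)) -` ball 0 \<eta>)"
        by (rule continuous_openin_preimage_gen) simp
      moreover have "\<sigma> (g t) \<in> ball 0 \<eta>" using chart by (simp add: straight_chart_def)
      moreover have "equivalent_initial_arcs t x" if "x \<in> {0<..1}" "\<sigma> (g x) \<in> ball 0 \<eta>" for x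
        using slide_endpoint[OF chart _ _ that(2)] that t by simp
      ultimately show ?thesis
        using t by (intro exI[of _ "{0<..1} \<inter> (\<lambda>x. \<sigma> (g x)) -` ball 0 \<eta>"]) auto
    qed
    show "1 \<in> {0<..1::real}" "s \<in> {0<..1}" using s by auto
    show "equivalent_initial_arcs y x" if "equivalent_initial_arcs x y" for x y
      using that by (rule equivalent_initial_arcs_sym)
    show "equivalent_initial_arcs x z" if "equivalent_initial_arcs x y" "equivalent_initial_arcs y z" for x y z
      using that by (rule equivalent_initial_arcs_trans)
  qed
  then obtain H where "self_homeomorphism H" "H ` g ` {0..1} = g ` {0..s}" "H (g 0) = g 0" "H (g 1) = g s"
    using equivalent_initial_arcs_def by blast
  moreover have "g s \<noteq> g 0" using g_inj s by (auto dest: inj_onD)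
  ultimately show ?thesis using that s by (simp add: path_image_def)
qed

end

section \<open>The half turn and its transfer to the arc\<close>

text \<open>\<open>K\<close> is a quarter turn about the midpoint, in a plane spanned by the
  direction \<open>u\<close> of the segment and any orthogonal unit vector \<open>v\<close>; the
  dimension bound supplies \<open>v\<close>. Its square negates that plane.\<close>

lemma half_turn_of_segment:
  fixes a b :: "'a::euclidean_space"
  assumes "a \<noteq> b" "2 \<le> DIM('a)"
  obtains K where "self_homeomorphism K" "\<And>x. x \<in> closed_segment a b \<Longrightarrow> K (K x) = a + b - x"
proof -
  define u where "u = sgn (b - a)"
  obtain w where w: "w \<noteq> 0" "orthogonal u w" using orthogonal_to_vector_exists[OF assms(2)] by blast
  define v where "v = sgn w"
  have uu: "u \<bullet> u = 1" using assms by (simp add: u_def norm_sgn dot_square_norm)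
  have vv: "v \<bullet> v = 1" using w by (simp add: v_def norm_sgn dot_square_norm)
  have uv: "u \<bullet> v = 0" using w by (simp add: v_def sgn_div_norm orthogonal_def)
  \<comment> \<open>The component orthogonal to the plane is kept, while \<open>u\<close> goes to
    \<open>k *\<^sub>R v\<close> and \<open>v\<close> to \<open>- k *\<^sub>R u\<close>. Thus
    \<open>L 1\<close> is the quarter turn and \<open>L (-1)\<close> its inverse.\<close>
  define L where "L = (\<lambda>k y. y - (y \<bullet> u) *\<^sub>R u - (y \<bullet> v) *\<^sub>R v + (k * (y \<bullet> u)) *\<^sub>R v - (k * (y \<bullet> v)) *\<^sub>R u)"
  have L_eq: "L k y = y - (y \<bullet> u) *\<^sub>R u - (y \<bullet> v) *\<^sub>R v + (k * (y \<bullet> u)) *\<^sub>R v - (k * (y \<bullet> v)) *\<^sub>R u" for k y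
    by (simp only: L_def)
  have Lu: "L k y \<bullet> u = - k * (y \<bullet> v)" and Lv: "L k y \<bullet> v = k * (y \<bullet> u)" for k y
    using uu vv uv by (simp_all add: L_def inner_simps inner_commute)
  have LL: "L (-1) (L 1 y) = y" "L 1 (L (-1) y) = y" "L 1 (L 1 y) = y - (2 * (y \<bullet> u)) *\<^sub>R u - (2 * (y \<bullet> v)) *\<^sub>R v" for y
  proof -
    have *: "L k (L j y) = L j y - (- j * (y \<bullet> v)) *\<^sub>R u - (j * (y \<bullet> u)) *\<^sub>R v
        + (k * (- j * (y \<bullet> v))) *\<^sub>R v - (k * (j * (y \<bullet> u))) *\<^sub>R u" for k j
      using L_eq[of k "L j y"] by (simp only: Lu Lv)
    have "L k (L j y) = y - ((1 + k * j) * (y \<bullet> u)) *\<^sub>R u - ((1 + k * j) * (y \<bullet> v)) *\<^sub>R v" for k j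
      unfolding *[of k j] unfolding L_eq[of j y] by (simp add: algebra_simps)
    then show "L (-1) (L 1 y) = y" "L 1 (L (-1) y) = y"
      "L 1 (L 1 y) = y - (2 * (y \<bullet> u)) *\<^sub>R u - (2 * (y \<bullet> v)) *\<^sub>R v"
      by simp_all
  qed
  define m where "m = (1/2) *\<^sub>R (a + b)"
  define K where "K = (\<lambda>x. m + L 1 (x - m))"
  have "self_homeomorphism K"
  proof (rule self_homeomorphismI)
    show "continuous_on UNIV K" "continuous_on UNIV (\<lambda>x. m + L (-1) (x - m))"
      unfolding K_def L_def by (intro continuous_intros)+
  qed (simp_all add: K_def LL)
  moreover have half: "(1/2) *\<^sub>R z + (1/2) *\<^sub>R z = z" for z :: 'a
    by (simp flip: scaleR_left_distrib)
  have "K (K x) = a + b - x" if x: "x \<in> closed_segment a b" for x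
  proof -
    obtain \<tau> where "x = (1 - \<tau>) *\<^sub>R a + \<tau> *\<^sub>R b" using x unfolding closed_segment_def by blast
    then have "x - m = (\<tau> - 1/2) *\<^sub>R (b - a)"
      using half[of a] half[of b] by (simp add: m_def algebra_simps)
    also have "\<dots> = ((\<tau> - 1/2) * norm (b - a)) *\<^sub>R u" using assms by (simp add: u_def sgn_div_norm)
    finally have xm: "x - m = ((\<tau> - 1/2) * norm (b - a)) *\<^sub>R u" .
    have "L 1 (L 1 (x - m)) = - (x - m)"
      unfolding LL xm using uu uv by (simp add: algebra_simps flip: scaleR_left_distrib)
    then have "K (K x) = m + m - x" by (simp add: K_def)
    also have "m + m = a + b" using half[of a] half[of b] by (simp add: m_def algebra_simps)
    finally show ?thesis .
  qed
  ultimately show ?thesis using that by blast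
qed

text \<open>The quarter turn of the straightened arc is conjugated by the unknotting homeomorphism.
  Only the square \<open>k \<circ> k\<close> is claimed to preserve the arc; its root
  \<open>k\<close> is exposed for the degree argument.\<close>

theorem (in arc_with_conical_points) flip_arc:
  assumes "2 \<le> DIM('a)"
  obtains k where "self_homeomorphism k" "(k \<circ> k) ` path_image g = path_image g"
    "k (k (g 0)) = g 1" "k (k (g 1)) = g 0"
proof -
  obtain H b where H: "self_homeomorphism H" "b \<noteq> g 0" "H ` path_image g = closed_segment (g 0) b"
    "H (g 0) = g 0" "H (g 1) = b"
    by (rule unknotting_homeomorphism)
  obtain K where K: "self_homeomorphism K" "\<And>x. x \<in> closed_segment (g 0) b \<Longrightarrow> K (K x) = g 0 + b - x"
    using half_turn_of_segment[of "g 0" b] H assms by metis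
  have inj: "inj H" and surj: "surj H" using self_homeomorphism_bij[OF H(1)] by (auto simp: bij_def)
  define k where "k = inv_into UNIV H \<circ> K \<circ> H"
  have "self_homeomorphism k"
    unfolding k_def comp_assoc by (intro self_homeomorphism_compose self_homeomorphism_inv H K)
  moreover have kk: "k (k x) = inv_into UNIV H (g 0 + b - H x)" if "x \<in> path_image g" for x
  proof -
    have "H x \<in> closed_segment (g 0) b" using that H(3) by blast
    then show ?thesis using K(2)[of "H x"] surj by (simp add: k_def surj_f_inv_f)
  qed
  moreover have "(k \<circ> k) ` path_image g = path_image g"
  proof -
    have "(k \<circ> k) ` path_image g = (\<lambda>y. inv_into UNIV H (g 0 + b - y)) ` H ` path_image g"
      unfolding image_image by (rule image_cong) (simp_all add: kk)
    also have "\<dots> = inv_into UNIV H ` (\<lambda>y. g 0 + b - y) ` closed_segment (g 0) b"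
      by (simp add: H(3) image_image)
    also have "(\<lambda>y. g 0 + b - y) ` closed_segment (g 0) b = closed_segment (g 0) b"
    proof -
      have sub: "g 0 + b - y \<in> closed_segment (g 0) b" if y: "y \<in> closed_segment (g 0) b" for y
      proof -
        obtain \<tau> where \<tau>: "0 \<le> \<tau>" "\<tau> \<le> 1" "y = (1 - \<tau>) *\<^sub>R g 0 + \<tau> *\<^sub>R b"
          using y by (auto simp: closed_segment_def)
        then show ?thesis
          unfolding closed_segment_def by (auto simp: algebra_simps intro!: exI[of _ "1 - \<tau>"])
      qed
      show ?thesis
      proof (intro equalityI subsetI)
        fix y assume "y \<in> closed_segment (g 0) b"
        then show "y \<in> (\<lambda>y. g 0 + b - y) ` closed_segment (g 0) b"
          using sub by (intro image_eqI[of _ _ "g 0 + b - y"]) auto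
      qed (use sub in auto)
    qed
    also have "inv_into UNIV H ` closed_segment (g 0) b = path_image g"
      unfolding H(3)[symmetric] using inj by (simp add: image_image)
    finally show ?thesis .
  qed
  moreover have ends: "g 0 \<in> path_image g" "g 1 \<in> path_image g" by (auto simp: path_image_def)
  have "k (k (g 0)) = inv_into UNIV H (H (g 1))" "k (k (g 1)) = inv_into UNIV H (H (g 0))"
    unfolding kk[OF ends(1)] kk[OF ends(2)] H(4,5) by simp_all
  then have "k (k (g 0)) = g 1" "k (k (g 1)) = g 0" using inj by simp_all
  ultimately show ?thesis using that by blast
qed

subsection \<open>Flipping tame arcs in the 3-sphere\<close>

text \<open>Continuity at \<open>p\<close> is checked on preimages of closed sets \<open>C\<close>.
  If \<open>p \<in> C\<close>, the complement of the preimage is open in the punctured space, which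
  is itself open. If \<open>p \<notin> C\<close>, then \<open>C\<close> is compact there; its
  preimage is the image of \<open>C\<close> under the inverse map, hence compact and so closed by
  the Hausdorff property.\<close>

lemma continuous_map_extend_homeomorphism:
  fixes h :: "'a \<Rightarrow> 'b::topological_space"
  assumes X: "compact_space X" "Hausdorff_space X" and p: "p \<in> topspace X"
    and hh': "homeomorphic_maps (subtopology X (topspace X - {p})) euclidean h h'"
    and K: "self_homeomorphism K"
  shows "continuous_map X X (\<lambda>x. if x = p then p else h' (K (h x)))"
proof -
  define F where "F = (\<lambda>x. if x = p then p else h' (K (h x)))"
  let ?Y = "subtopology X (topspace X - {p})"
  have h: "continuous_map ?Y euclidean h" and h': "continuous_map euclidean ?Y h'"
    and h'h: "\<And>x. x \<in> topspace X - {p} \<Longrightarrow> h' (h x) = x" and hh: "\<And>y. h (h' y) = y"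
    using hh' by (auto simp: homeomorphic_maps_def)
  have h'_in: "h' y \<in> topspace X - {p}" for y
    using continuous_map_image_subset_topspace[OF h'] by auto
  have cont: "continuous_map ?Y X F"
  proof (rule continuous_map_eq)
    have "continuous_map euclidean euclidean K"
      using self_homeomorphism_continuous[OF K] by simp
    then have "continuous_map ?Y ?Y (h' \<circ> (K \<circ> h))"
      by (intro continuous_map_compose[OF _ h'] continuous_map_compose[OF h])
    then show "continuous_map ?Y X (h' \<circ> (K \<circ> h))"
      using continuous_map_into_fulltopology by blast
  qed (auto simp: F_def)
  have open_Y: "openin X (topspace X - {p})"
    using closedin_Hausdorff_singleton[OF X(2) p] by (simp add: openin_diff)
  have maps: "F \<in> topspace X \<rightarrow> topspace X"
    using h'_in p by (auto simp: F_def)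
  have "closedin X {x \<in> topspace X. F x \<in> C}" if C: "closedin X C" for C
  proof (cases "p \<in> C")
    case True
    have "openin ?Y {x \<in> topspace ?Y. F x \<in> topspace X - C}"
      using cont C by (intro openin_continuous_map_preimage) auto
    then have "openin X {x \<in> topspace ?Y. F x \<in> topspace X - C}"
      using open_Y by (simp add: openin_open_subtopology)
    moreover have "topspace X - {x \<in> topspace X. F x \<in> C} = {x \<in> topspace ?Y. F x \<in> topspace X - C}"
      using h'_in True by (auto simp: F_def)
    ultimately show ?thesis by (simp add: closedin_def)
  next
    case False
    have "compactin ?Y C"
      using C False X closedin_compact_space closedin_subset by (fastforce simp: compactin_subtopology)
    then have "compact (h ` C)" using image_compactin[OF _ h] by simp
    then have "compact (inv_into UNIV K ` h ` C)"
      by (intro compact_continuous_image self_homeomorphism_continuous self_homeomorphism_inv K)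
    then have "compactin ?Y (h' ` inv_into UNIV K ` h ` C)" using image_compactin[OF _ h'] by simp
    then have clo: "closedin X (h' ` inv_into UNIV K ` h ` C)"
      using X(2) by (simp add: compactin_imp_closedin compactin_subtopology)
    have bij: "bij K" using K by (rule self_homeomorphism_bij)
    have "{x \<in> topspace X. F x \<in> C} = h' ` inv_into UNIV K ` h ` C" (is "?L = ?R")
    proof (intro equalityI subsetI)
      fix x assume x: "x \<in> ?L"
      then have "x \<noteq> p" using False by (auto simp: F_def)
      then have "h' (K (h x)) \<in> C" "x = h' (inv_into UNIV K (h (h' (K (h x)))))"
        using x h'h hh bij by (auto simp: F_def bij_is_inj)
      then show "x \<in> ?R" by blast
    next
      fix x assume "x \<in> ?R"
      then obtain c where c: "c \<in> C" "x = h' (inv_into UNIV K (h c))" by blast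
      then have "c \<in> topspace X - {p}" using C False closedin_subset by blast
      then show "x \<in> ?L" using c h'_in h'h hh bij by (auto simp: F_def bij_is_surj surj_f_inv_f)
    qed
    then show ?thesis using clo by simp
  qed
  then have "continuous_map X X F"
    using maps by (simp add: continuous_map_closedin Pi_iff)
  then show ?thesis by (simp add: F_def)
qed

text \<open>Compactness is transported from the unit sphere of \<open>real^4\<close>, whose four
  basis vectors give an \<open>nsphere\<close> of index \<open>4 - 1\<close>.\<close>

lemma compact_space_S3: "compact_space S3"
proof -
  let ?B = "Basis :: (real^4) set"
  obtain f :: "(nat \<Rightarrow> real) \<Rightarrow> real^4" and g
    where fg: "homeomorphic_maps (nsphere (4 - 1)) (top_of_set (sphere 0 1 \<inter> span ?B)) f g"
    by (rule homeomorphic_maps_nsphere_euclidean_sphere[of ?B 4])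
      (auto simp: independent_Basis pairwise_def orthogonal_def inner_Basis)
  have "compact_space (top_of_set (sphere (0::real^4) 1))"
    by (simp add: compact_space_subtopology)
  then show ?thesis
    using fg homeomorphic_maps_imp_homeomorphic_space homeomorphic_compact_space by fastforce
qed

lemma Hausdorff_space_S3: "Hausdorff_space S3"
  unfolding nsphere_def by (intro Hausdorff_space_subtopology Hausdorff_Euclidean_space)

lemma S3_top_of_set: "S3 = top_of_set {x. (\<Sum>i\<le>3. x i ^ 2) = 1 \<and> (\<forall>i>3. x i = 0)}"
  by (simp add: nsphere euclidean_product_topology)

section \<open>Realizations of the two graphs and the flip in the sphere\<close>

text \<open>Barycentric coordinates along the edge joining 0 and 1. Restricted to
  \<open>{0..0}\<close> it gives the one-vertex graph, so both graphs share one embedding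
  construction.\<close>

definition edge_point :: "real \<Rightarrow> nat \<Rightarrow> real" where
  "edge_point t = (\<lambda>i. if i = 0 then 1 - t else if i = 1 then t else 0)"

lemma edge_point_0: "edge_point 0 = vertex_point 0"
  by (auto simp: edge_point_def vertex_point_def indicator_def)

lemma edge_point_1: "edge_point 1 = vertex_point 1"
  by (auto simp: edge_point_def vertex_point_def indicator_def)

lemma inj_edge_point: "inj_on edge_point A"
proof (rule inj_onI)
  fix s t assume "edge_point s = edge_point t"
  then have "edge_point s 1 = edge_point t 1" by simp
  then show "s = t" by (simp add: edge_point_def)
qed

lemma continuous_on_edge_point: "continuous_on A edge_point"
proof (rule continuous_on_coordinatewise_then_product)
  show "continuous_on A (\<lambda>t. edge_point t i)" for i
    by (cases "i = 0"; cases "i = 1") (auto simp: edge_point_def intro!: continuous_intros)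
qed

lemma closed_edge_01: "closed_edge {0, 1} = edge_point ` {0..1}"
proof (intro equalityI subsetI)
  fix x :: "nat \<Rightarrow> real" assume "x \<in> closed_edge {0, 1}"
  then have x: "\<And>i. 0 \<le> x i" "\<And>i. i \<notin> {0, 1} \<Longrightarrow> x i = 0" "x 0 + x 1 = 1"
    by (auto simp: closed_edge_def)
  then have "x = edge_point (x 1)" by (auto simp: edge_point_def fun_eq_iff)
  moreover have "x 1 \<in> {0..1}" using x(1)[of 0] x(1)[of 1] x(3) by auto
  ultimately show "x \<in> edge_point ` {0..1}" by blast
qed (auto simp: closed_edge_def edge_point_def)

lemma edges_complete_graph_1: "edges (complete_graph 1) = {}"
proof -
  have "card e \<noteq> 2" if "e \<subseteq> {..<1::nat}" for e
    using card_mono[OF _ that] by auto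
  then show ?thesis by (auto simp: complete_graph_def)
qed

lemma edges_complete_graph_2: "edges (complete_graph 2) = {{0, 1}}"
proof -
  have "{..<2} = {0, 1::nat}" by auto
  then show ?thesis by (auto simp: complete_graph_def card_2_iff)
qed

lemma realization_complete_graph_1: "realization (complete_graph 1) = top_of_set (edge_point ` {0..0})"
  unfolding realization_def edges_complete_graph_1
  by (simp add: complete_graph_def lessThan_Suc euclidean_product_topology edge_point_0)

lemma realization_complete_graph_2: "realization (complete_graph 2) = top_of_set (edge_point ` {0..1})"
proof -
  have "vertices (complete_graph 2) = {0, 1}" by (auto simp: complete_graph_def)
  moreover have "{edge_point 0, edge_point 1} \<union> edge_point ` {0..1} = edge_point ` {0..1}"
    by auto
  ultimately show ?thesis
    by (simp add: realization_def edges_complete_graph_2 euclidean_product_topology closed_edge_01[unfolded One_nat_def]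
        edge_point_0 edge_point_1[unfolded One_nat_def])
qed

lemma flip_tame_arc:
  assumes "tame_embedding (complete_graph 2) f"
  obtains k where "homeomorphic_map S3 S3 k" "orientation_preserving k"
    "k ` f ` closed_edge {0, 1} = f ` closed_edge {0, 1}"
    "k (f (vertex_point 0)) = f (vertex_point 1)" "k (f (vertex_point 1)) = f (vertex_point 0)"
proof -
  let ?X = "realization (complete_graph 2)"
  have top: "topspace ?X = edge_point ` {0..1}" by (simp add: realization_complete_graph_2)
  define \<Gamma> where "\<Gamma> = f ` edge_point ` {0..1}"
  obtain p h S where p: "p \<in> topspace S3 - \<Gamma>"
    and hom: "homeomorphic_map (subtopology S3 (topspace S3 - {p})) (euclidean :: (real ^ 3) topology) h"
    and S: "finite S" "h ` \<Gamma> = (\<Union>(a, b)\<in>S. closed_segment a b)"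
    using assms unfolding tame_embedding_def tame_def top \<Gamma>_def by (elim exE conjE)
  have emb: "embedding_map ?X S3 f"
    using assms by (simp add: tame_embedding_def)
  let ?Y = "subtopology S3 (topspace S3 - {p})"
  obtain h' where hh': "homeomorphic_maps ?Y euclidean h h'"
    using hom homeomorphic_map_maps by blast
  have h: "continuous_map ?Y euclidean h" and h': "continuous_map euclidean ?Y h'"
    and h'h: "\<And>x. x \<in> topspace S3 - {p} \<Longrightarrow> h' (h x) = x" and hh: "\<And>y. h (h' y) = y"
    using hh' by (auto simp: homeomorphic_maps_def)
  have h'_in: "h' y \<in> topspace S3 - {p}" for y
    using continuous_map_image_subset_topspace[OF h'] by auto
  have f: "continuous_map ?X S3 f" "inj_on f (topspace ?X)"
    using emb unfolding embedding_map_def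
    by (auto dest: homeomorphic_imp_continuous_map continuous_map_into_fulltopology homeomorphic_imp_injective_map)
  have \<Gamma>: "\<Gamma> \<subseteq> topspace S3 - {p}"
    using p continuous_map_image_subset_topspace[OF f(1)] unfolding \<Gamma>_def top by blast
  define g where "g = h \<circ> (f \<circ> edge_point)"
  have g_image: "path_image g = h ` \<Gamma>" by (simp add: g_def \<Gamma>_def path_image_def image_comp)
  have "continuous_map (top_of_set {0..1}) ?X edge_point"
    by (simp add: realization_complete_graph_2 continuous_on_edge_point)
  then have "continuous_map (top_of_set {0..1}) S3 (f \<circ> edge_point)"
    using f(1) continuous_map_compose by blast
  moreover have "(f \<circ> edge_point) t \<in> topspace S3 - {p}" if "t \<in> {0..1}" for t
  proof -
    have "(f \<circ> edge_point) t \<in> \<Gamma>" using that by (simp add: \<Gamma>_def)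
    then show ?thesis using \<Gamma> by blast
  qed
  ultimately have "continuous_map (top_of_set {0..1}) ?Y (f \<circ> edge_point)"
    unfolding continuous_map_in_subtopology by auto
  then have "continuous_map (top_of_set {0..1}) euclidean g"
    unfolding g_def using h continuous_map_compose by blast
  moreover have "inj_on g {0..1}"
    unfolding g_def
  proof (intro comp_inj_on inj_edge_point)
    show "inj_on f (edge_point ` {0..1})" using f(2) top by simp
    have "inj_on h \<Gamma>" using h'h \<Gamma> by (metis inj_onI subsetD)
    then show "inj_on h ((f \<circ> edge_point) ` {0..1})" by (simp add: \<Gamma>_def image_comp)
  qed
  ultimately have arc: "arc g" by (simp add: arc_def path_def)
  interpret arc_with_conical_points g
  proof
    show "\<exists>r D. 0 < r \<and> (\<forall>d\<in>D. norm d = 1) \<and>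
      path_image g \<inter> (ball q r - {q}) = (\<lambda>(d, s). q + s *\<^sub>R d) ` (D \<times> {0<..<r})" for q
      unfolding g_image S(2) using segments_locally_conical[OF S(1), of q] by metis
  qed (rule arc)
  obtain K where K: "self_homeomorphism K" "(K \<circ> K) ` path_image g = path_image g"
    "K (K (g 0)) = g 1" "K (K (g 1)) = g 0"
    by (rule flip_arc) auto
  define F where "F = (\<lambda>K x. if x = p then p else h' (K (h x)))"
  have F: "continuous_map S3 S3 (F K)" if "self_homeomorphism K" for K
    unfolding F_def using p
    by (intro continuous_map_extend_homeomorphism[OF compact_space_S3 Hausdorff_space_S3 _ hh' that]) auto
  \<comment> \<open>Extension by fixing \<open>p\<close> respects composition because
    \<open>h'\<close> never takes the value \<open>p\<close>. The inverse of \<open>F K\<close> is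
    therefore the extension of the inverse of \<open>K\<close>.\<close>
  have FF: "F K (F L x) = F (K \<circ> L) x" for K L x
    using h'_in hh by (auto simp: F_def)
  have bij: "bij K" using K(1) by (rule self_homeomorphism_bij)
  have F_id: "F id x = x" if "x \<in> topspace S3" for x
    using that h'h by (auto simp: F_def)
  have hom_F: "homeomorphic_map S3 S3 (F K)"
  proof -
    have "inv_into UNIV K \<circ> K = id" "K \<circ> inv_into UNIV K = id"
      using bij by (simp_all add: bij_is_inj bij_is_surj surj_iff[symmetric])
    then have "homeomorphic_maps S3 S3 (F K) (F (inv_into UNIV K))"
      using F K(1) self_homeomorphism_inv F_id FF by (auto simp: homeomorphic_maps_def)
    then show ?thesis by (rule homeomorphic_maps_imp_map)
  qed
  define k where "k = F K \<circ> F K"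
  have k_eq: "k x = F (K \<circ> K) x" for x by (simp add: k_def FF)
  have k\<Gamma>: "k x = h' ((K \<circ> K) (h x))" if "x \<in> \<Gamma>" for x
    using that \<Gamma> by (auto simp: k_eq F_def)
  have "k ` \<Gamma> = h' ` (K \<circ> K) ` h ` \<Gamma>"
    unfolding image_image by (intro image_cong refl k\<Gamma>)
  also have "\<dots> = h' ` h ` \<Gamma>" using K(2) g_image by simp
  also have "\<dots> = \<Gamma>"
    unfolding image_image using h'h \<Gamma> by (force simp: image_iff)
  finally have "k ` f ` closed_edge {0, 1} = f ` closed_edge {0, 1}"
    by (simp only: \<Gamma>_def closed_edge_01)
  moreover have "homeomorphic_map S3 S3 k"
    unfolding k_def using hom_F hom_F by (rule homeomorphic_map_compose)
  moreover have "orientation_preserving k"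
  proof -
    have "Brouwer_degree2 3 k = Brouwer_degree2 3 (F K) * Brouwer_degree2 3 (F K)"
      unfolding k_def by (intro Brouwer_degree2_compose F K(1))
    also have "\<dots> = 1"
      using Brouwer_degree2_homeomorphic_map[OF hom_F] by (metis abs_mult_self_eq mult_1)
    finally show ?thesis by (simp add: orientation_preserving_def)
  qed
  moreover have "k (f (edge_point 0)) = f (edge_point 1)" "k (f (edge_point 1)) = f (edge_point 0)"
  proof -
    have "f (edge_point 0) \<in> \<Gamma>" "f (edge_point 1) \<in> \<Gamma>" by (auto simp: \<Gamma>_def)
    moreover from this have "h' (h (f (edge_point 0))) = f (edge_point 0)" "h' (h (f (edge_point 1))) = f (edge_point 1)"
      using h'h \<Gamma> by blast+
    ultimately show "k (f (edge_point 0)) = f (edge_point 1)" "k (f (edge_point 1)) = f (edge_point 0)"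
      using K(3,4) k\<Gamma> by (simp_all add: g_def)
  qed
  ultimately show ?thesis using that by (simp add: edge_point_0 edge_point_1)
qed

subsection \<open>Existence of tame embeddings\<close>

text \<open>Projection from \<open>north_pole\<close>; sphere coordinates 0, 1, 2 become vector
  components 1, 2, 3.\<close>

definition stereographic :: "(nat \<Rightarrow> real) \<Rightarrow> real ^ 3" where
  "stereographic x = (\<chi> i. (if i = 1 then x 0 else if i = 2 then x 1 else x 2) / (1 - x 3))"

definition inv_stereographic :: "real ^ 3 \<Rightarrow> nat \<Rightarrow> real" where
  "inv_stereographic y = (\<lambda>i. (if i = 0 then 2 * y $ 1 else if i = 1 then 2 * y $ 2 else if i = 2 then 2 * y $ 3
     else if i = 3 then y \<bullet> y - 1 else 0) / (1 + y \<bullet> y))"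

definition north_pole :: "nat \<Rightarrow> real" where
  "north_pole = (\<lambda>i. if i = 3 then 1 else 0)"

lemma topspace_S3: "x \<in> topspace S3 \<longleftrightarrow> (x 0)\<^sup>2 + (x 1)\<^sup>2 + (x 2)\<^sup>2 + (x 3)\<^sup>2 = 1 \<and> (\<forall>i>3. x i = 0)"
proof -
  have "(\<Sum>i\<le>3. f i) = f 0 + f 1 + f 2 + f 3" for f :: "nat \<Rightarrow> real"
    by (simp add: eval_nat_numeral)
  then show ?thesis unfolding S3_top_of_set by simp
qed

lemma inner_3: "(x :: real ^ 3) \<bullet> y = x $ 1 * y $ 1 + x $ 2 * y $ 2 + x $ 3 * y $ 3"
  by (simp add: inner_vec_def sum_3)

lemma north_pole_in_S3: "north_pole \<in> topspace S3"
  by (simp add: topspace_S3 north_pole_def)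

lemma homeomorphic_maps_stereographic:
  "homeomorphic_maps (subtopology S3 (topspace S3 - {north_pole})) euclidean stereographic inv_stereographic"
proof -
  have S3_top: "S3 = top_of_set (topspace S3)" unfolding S3_top_of_set by simp
  have Y: "subtopology S3 (topspace S3 - {north_pole}) = top_of_set (topspace S3 - {north_pole})"
    by (metis S3_top subtopology_subtopology Int_absorb1 Diff_subset)
  \<comment> \<open>On the sphere, height 1 forces all other coordinates to vanish; this keeps the
    denominator nonzero off the pole.\<close>
  have x3: "x 3 \<noteq> 1" if x: "x \<in> topspace S3" "x \<noteq> north_pole" for x
  proof
    assume 1: "x 3 = 1"
    then have "(x 0)\<^sup>2 + (x 1)\<^sup>2 + (x 2)\<^sup>2 = 0" using x(1) by (simp add: topspace_S3)
    then have "x 0 = 0" "x 1 = 0" "x 2 = 0"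
      by (simp_all add: add_nonneg_eq_0_iff)
    moreover have "x i = 0" if "i > 3" for i using that x(1) by (simp add: topspace_S3)
    moreover have "i = 0 \<or> i = 1 \<or> i = 2 \<or> i = 3 \<or> i > 3" for i :: nat by auto
    ultimately have "x i = north_pole i" for i
      using 1 unfolding north_pole_def by (metis less_irrefl)
    then show False using x(2) by blast
  qed
  have nz: "1 + y \<bullet> y \<noteq> 0" for y :: "real ^ 3" by (smt (verit) inner_ge_zero)
  have in_S3: "inv_stereographic y \<in> topspace S3" for y
  proof -
    have "(2 * y $ 1)\<^sup>2 + (2 * y $ 2)\<^sup>2 + (2 * y $ 3)\<^sup>2 + (y \<bullet> y - 1)\<^sup>2 = (1 + y \<bullet> y)\<^sup>2"
      by (simp add: inner_3 power2_eq_square algebra_simps)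
    then show ?thesis
      using nz[of y] by (simp add: topspace_S3 inv_stereographic_def power_divide flip: add_divide_distrib)
  qed
  have "inv_stereographic y 3 \<noteq> 1" for y
    using nz[of y] by (simp add: inv_stereographic_def divide_eq_1_iff)
  then have not_pole: "inv_stereographic y \<noteq> north_pole" for y
    by (metis north_pole_def)
  show ?thesis
    unfolding homeomorphic_maps_def Y
  proof (intro conjI ballI)
    have coord: "continuous_on A (\<lambda>x. x j)" for A :: "(nat \<Rightarrow> real) set" and j
      by (rule continuous_on_product_then_coordinatewise[OF continuous_on_id])
    have "continuous_on (topspace S3 - {north_pole})
            (\<lambda>x. (if i = 1 then x 0 else if i = 2 then x 1 else x 2) / (1 - x 3))" for i :: 3
    proof (intro continuous_on_divide continuous_on_diff continuous_on_const coord ballI)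
      show "continuous_on (topspace S3 - {north_pole}) (\<lambda>x. if i = 1 then x 0 else if i = 2 then x 1 else x 2)"
        by (cases "i = 1"; cases "i = 2"; simp add: coord)
    qed (use x3 in fastforce)
    then have "continuous_on (topspace S3 - {north_pole}) stereographic"
      unfolding stereographic_def by (intro continuous_on_vec_lambda)
    then show "continuous_map (top_of_set (topspace S3 - {north_pole})) euclidean stereographic" by simp
    have "continuous_on UNIV (\<lambda>y. inv_stereographic y i)" for i
    proof -
      consider "i = 0" | "i = 1" | "i = 2" | "i = 3" | "i > 3" by linarith
      then show ?thesis
        by cases (auto simp: inv_stereographic_def nz intro!: continuous_intros)
    qed
    then have "continuous_on UNIV inv_stereographic"
      by (rule continuous_on_coordinatewise_then_product)
    then show "continuous_map euclidean (top_of_set (topspace S3 - {north_pole})) inv_stereographic"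
      using in_S3 not_pole by (auto simp: continuous_map_in_subtopology)
  next
    fix x assume "x \<in> topspace (top_of_set (topspace S3 - {north_pole}))"
    then have x: "x \<in> topspace S3" "x 3 \<noteq> 1" using x3 by auto
    define y where "y = stereographic x"
    have y: "y $ 1 = x 0 / (1 - x 3)" "y $ 2 = x 1 / (1 - x 3)" "y $ 3 = x 2 / (1 - x 3)"
      by (simp_all add: y_def stereographic_def)
    have "y \<bullet> y = ((x 0)\<^sup>2 + (x 1)\<^sup>2 + (x 2)\<^sup>2) / (1 - x 3)\<^sup>2"
      by (simp add: inner_3 y power2_eq_square add_divide_distrib)
    \<comment> \<open>The sphere equation factors as a difference of squares, which cancels one
      power of \<open>1 - x 3\<close>.\<close>
    also have "(x 0)\<^sup>2 + (x 1)\<^sup>2 + (x 2)\<^sup>2 = (1 + x 3) * (1 - x 3)"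
      using x(1) by (simp add: topspace_S3 power2_eq_square algebra_simps)
    finally have yy: "y \<bullet> y = (1 + x 3) / (1 - x 3)" using x(2) by (simp add: power2_eq_square)
    have 1: "1 + y \<bullet> y = 2 / (1 - x 3)" and 2: "y \<bullet> y - 1 = 2 * x 3 / (1 - x 3)"
      unfolding yy using x(2) by (simp_all add: field_simps)
    have "inv_stereographic y i = x i" for i
    proof -
      consider "i = 0" | "i = 1" | "i = 2" | "i = 3" | "i > 3" by linarith
      then show ?thesis
        unfolding inv_stereographic_def 1 2 y using x by cases (simp_all add: topspace_S3)
    qed
    then show "inv_stereographic (stereographic x) = x" by (auto simp: y_def)
  next
    fix y :: "real ^ 3"
    have "1 - inv_stereographic y 3 = 2 / (1 + y \<bullet> y)"
      using nz[of y] by (simp add: inv_stereographic_def field_simps)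
    then show "stereographic (inv_stereographic y) = y"
      using nz[of y] by (simp add: vec_eq_iff forall_3 stereographic_def) (simp add: inv_stereographic_def)
  qed
qed

text \<open>The edge is laid along a coordinate axis and lifted by inverse stereographic projection,
  so projecting back exhibits it as one segment. The value \<open>c = 0\<close> gives a degenerate
  segment for the single vertex, \<open>c = 1\<close> the full edge.\<close>

lemma tame_embedding_exists:
  assumes "realization \<gamma> = top_of_set (edge_point ` {0..c})" "0 \<le> c"
  shows "\<exists>f. tame_embedding \<gamma> f"
proof -
  define e where "e = (\<lambda>x :: nat \<Rightarrow> real. x 1 *\<^sub>R (axis 1 1 :: real ^ 3))"
  define f where "f = inv_stereographic \<circ> e"
  note hom = homeomorphic_maps_stereographic
  let ?Y = "subtopology S3 (topspace S3 - {north_pole})"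
  have cont: "continuous_map euclidean ?Y inv_stereographic"
    and st: "\<And>y. stereographic (inv_stereographic y) = y"
    using hom by (auto simp: homeomorphic_maps_def)
  have image: "inv_stereographic y \<in> topspace S3 - {north_pole}" for y
    using continuous_map_image_subset_topspace[OF cont] by auto
  have top: "topspace (realization \<gamma>) = edge_point ` {0..c}" by (simp add: assms)
  have "embedding_map (realization \<gamma>) S3 f"
  proof (rule continuous_imp_embedding_map)
    have "continuous_on (edge_point ` {0..c}) e"
      unfolding e_def
      by (intro continuous_intros continuous_on_product_then_coordinatewise[OF continuous_on_id])
    then have "continuous_map (realization \<gamma>) euclidean e" by (simp add: assms)
    then have "continuous_map (realization \<gamma>) ?Y f"
      unfolding f_def using cont by (rule continuous_map_compose)
    then show "continuous_map (realization \<gamma>) S3 f" by (rule continuous_map_into_fulltopology)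
    have "compact (edge_point ` {0..c})"
      by (intro compact_continuous_image continuous_on_edge_point) simp
    then show "compact_space (realization \<gamma>)" by (simp add: assms compact_space_subtopology)
    show "inj_on f (topspace (realization \<gamma>))"
    proof (rule inj_onI)
      fix x y assume xy: "x \<in> topspace (realization \<gamma>)" "y \<in> topspace (realization \<gamma>)" "f x = f y"
      then have "e x = e y" using st by (metis comp_apply f_def)
      then have "x 1 = y 1" by (simp add: e_def axis_eq_0_iff)
      then show "x = y" using xy(1,2) unfolding top by (auto simp: edge_point_def)
    qed
  qed (rule Hausdorff_space_S3)
  moreover have "tame (f ` topspace (realization \<gamma>))"
    unfolding tame_def
  proof (intro exI conjI)
    show "north_pole \<in> topspace S3 - f ` topspace (realization \<gamma>)"
      using image north_pole_in_S3 unfolding f_def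
      by (metis (no_types, lifting) DiffD2 DiffI comp_apply imageE singletonI)
    show "homeomorphic_map ?Y euclidean stereographic"
      using hom by (rule homeomorphic_maps_imp_map)
    show "finite {(0, c *\<^sub>R axis 1 1 :: real ^ 3)}" by simp
    have "stereographic ` f ` topspace (realization \<gamma>) = (\<lambda>t. t *\<^sub>R axis 1 1) ` {0..c}"
      unfolding top f_def image_image by (simp add: st e_def edge_point_def)
    also have "\<dots> = (\<lambda>t. t *\<^sub>R axis 1 1) ` ((\<lambda>u. c * u) ` {0..1})"
      using assms(2) by (simp add: image_mult_atLeastAtMost_if)
    also have "\<dots> = closed_segment 0 (c *\<^sub>R axis 1 1)"
      unfolding closed_segment_image_interval image_image by (simp add: mult.commute)
    finally show "stereographic ` f ` topspace (realization \<gamma>) =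
        (\<Union>(a, b)\<in>{(0, c *\<^sub>R axis 1 1)}. closed_segment a b)" by simp
  qed
  ultimately show ?thesis unfolding tame_embedding_def by blast
qed

subsection \<open>Topological symmetry groups\<close>

text \<open>In a complete graph adjacency means being distinct vertices, so every permutation is an
  automorphism. If orientation preserving homeomorphisms already induce all of them, neither group
  can be smaller or larger.\<close>

lemma TSG_eq_BijGroup:
  assumes "\<And>\<sigma>. \<sigma> \<in> Bij {..<n} \<Longrightarrow>
    \<exists>h. graph_homeomorphism (complete_graph n) f h \<and> orientation_preserving h \<and> induces (complete_graph n) f h \<sigma>"
  shows "TSG (complete_graph n) f = BijGroup {..<n}" "TSG_plus (complete_graph n) f = BijGroup {..<n}"
proof -
  have "graph_automorphisms (complete_graph n) = Bij {..<n}"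
  proof -
    have "{\<sigma> u, \<sigma> v} \<in> edges (complete_graph n) \<longleftrightarrow> {u, v} \<in> edges (complete_graph n)"
      if "\<sigma> \<in> Bij {..<n}" "u < n" "v < n" for \<sigma> u v
    proof -
      have bij: "bij_betw \<sigma> {..<n} {..<n}" using that(1) by (simp add: Bij_def)
      then have "\<sigma> u = \<sigma> v \<longleftrightarrow> u = v" "\<sigma> u < n" "\<sigma> v < n"
        using that(2,3) by (auto simp: bij_betw_def inj_on_eq_iff)
      then show ?thesis using that(2,3) by (cases "u = v") (simp_all add: complete_graph_def)
    qed
    then show ?thesis by (auto simp: graph_automorphisms_def complete_graph_def)
  qed
  then have "Aut (complete_graph n) = BijGroup {..<n}"
    by (simp add: Aut_def BijGroup_def complete_graph_def)
  moreover have "carrier (BijGroup {..<n}) = Bij {..<n}" by (simp add: BijGroup_def)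
  moreover have "{\<sigma> \<in> Bij {..<n}. \<exists>h. graph_homeomorphism (complete_graph n) f h \<and> induces (complete_graph n) f h \<sigma>} = Bij {..<n}"
    "{\<sigma> \<in> Bij {..<n}. \<exists>h. graph_homeomorphism (complete_graph n) f h \<and> orientation_preserving h \<and>
        induces (complete_graph n) f h \<sigma>} = Bij {..<n}"
    using assms by blast+
  ultimately show "TSG (complete_graph n) f = BijGroup {..<n}" "TSG_plus (complete_graph n) f = BijGroup {..<n}"
    unfolding TSG_def TSG_plus_def by (simp_all add: BijGroup_def)
qed

lemma identity_induced:
  "\<exists>h. graph_homeomorphism (complete_graph n) f h \<and> orientation_preserving h \<and>
       induces (complete_graph n) f h (\<lambda>x\<in>{..<n}. x)"
proof -
  have "(\<lambda>x\<in>{..<n}. x) ` e = e" if "e \<subseteq> {..<n}" for e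
    using that by (simp add: subset_eq)
  then have "graph_homeomorphism (complete_graph n) f id \<and> orientation_preserving id \<and>
      induces (complete_graph n) f id (\<lambda>x\<in>{..<n}. x)"
    by (auto simp: graph_homeomorphism_def orientation_preserving_def induces_def complete_graph_def)
  then show ?thesis by blast
qed

lemma Bij_1: "Bij {..<1} = {\<lambda>x\<in>{..<1::nat}. x}"
  by (auto simp: Bij_def extensional_def bij_betw_def inj_on_def fun_eq_iff lessThan_Suc)

lemma Bij_2: "Bij {..<2} = {\<lambda>x\<in>{..<2}. x, \<lambda>x\<in>{..<2::nat}. 1 - x}"
proof (intro equalityI subsetI)
  have 2: "{..<2} = {0, 1::nat}" by auto
  fix \<sigma> :: "nat \<Rightarrow> nat" assume "\<sigma> \<in> Bij {..<2}"
  then have "\<sigma> \<in> extensional {0, 1}" "inj_on \<sigma> {0, 1}" "\<sigma> ` {0, 1} = {0, 1}" by (auto simp: Bij_def bij_betw_def 2)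
  then have "\<sigma> 0 \<in> {0, 1}" "\<sigma> 1 \<in> {0, 1}" "\<sigma> 0 \<noteq> \<sigma> 1" by (blast, blast, simp)
  then have "\<sigma> 0 = 0 \<and> \<sigma> 1 = 1 \<or> \<sigma> 0 = 1 \<and> \<sigma> 1 = 0" by auto
  then show "\<sigma> \<in> {\<lambda>x\<in>{..<2}. x, \<lambda>x\<in>{..<2::nat}. 1 - x}"
    using \<open>\<sigma> \<in> extensional {0, 1}\<close> by (auto simp: 2 fun_eq_iff extensional_def)
next
  have 2: "{..<2} = {0, 1::nat}" by auto
  fix \<sigma> :: "nat \<Rightarrow> nat" assume "\<sigma> \<in> {\<lambda>x\<in>{..<2}. x, \<lambda>x\<in>{..<2::nat}. 1 - x}"
  then show "\<sigma> \<in> Bij {..<2}"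
    by (auto simp: Bij_def bij_betw_def inj_on_def 2)
qed

lemma BijGroup_2_iso: "BijGroup {..<2::nat} \<cong> integer_mod_group 2"
proof -
  have 2: "{..<2} = {0, 1::nat}" by auto
  \<comment> \<open>The image of vertex 0 tells the identity (0) from the swap (1).\<close>
  have "(\<lambda>\<sigma>. int (\<sigma> 0)) \<in> iso (BijGroup {..<2::nat}) (integer_mod_group 2)"
  proof (rule isoI)
    show "(\<lambda>\<sigma>. int (\<sigma> 0)) \<in> hom (BijGroup {..<2::nat}) (integer_mod_group 2)"
      by (rule homI) (auto simp: BijGroup_def Bij_2 carrier_integer_mod_group compose_def)
    show "bij_betw (\<lambda>\<sigma>. int (\<sigma> 0)) (carrier (BijGroup {..<2::nat})) (carrier (integer_mod_group 2))"
    proof -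
      have "carrier (BijGroup {..<2::nat}) = {\<lambda>x\<in>{0, 1}. x, \<lambda>x\<in>{0, 1}. 1 - x}"
        using Bij_2 by (simp add: BijGroup_def 2)
      moreover have "carrier (integer_mod_group 2) = {0, 1}"
        by (auto simp: carrier_integer_mod_group)
      ultimately show ?thesis by (auto simp: bij_betw_def inj_on_def)
    qed
  qed
  then show ?thesis by (auto simp: is_iso_def)
qed

lemma trivial_groups_iso:
  assumes "trivial_group G" "trivial_group H"
  shows "G \<cong> H"
proof -
  have "(\<lambda>_. \<one>\<^bsub>H\<^esub>) \<in> iso G H"
    using assms by (auto simp: trivial_group_def iso_def hom_def bij_betw_def group.is_monoid monoid.l_one)
  then show ?thesis by (auto simp: is_iso_def)
qed

lemma TSG_complete_graph_1:
  "TSG (complete_graph 1) f = BijGroup {..<1}" "TSG_plus (complete_graph 1) f = BijGroup {..<1}"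
proof -
  have "\<exists>h. graph_homeomorphism (complete_graph 1) f h \<and> orientation_preserving h \<and>
      induces (complete_graph 1) f h \<sigma>" if "\<sigma> \<in> Bij {..<1}" for \<sigma>
    using that identity_induced[of 1 f] unfolding Bij_1 by simp
  then show "TSG (complete_graph 1) f = BijGroup {..<1}" "TSG_plus (complete_graph 1) f = BijGroup {..<1}"
    using TSG_eq_BijGroup[of 1 f] by blast+
qed

text \<open>The identity homeomorphism induces the trivial permutation and the flip of the arc
  induces the swap; there are no others.\<close>

lemma TSG_complete_graph_2:
  assumes "tame_embedding (complete_graph 2) f"
  shows "TSG (complete_graph 2) f = BijGroup {..<2}" "TSG_plus (complete_graph 2) f = BijGroup {..<2}"
proof -
  have 2: "{..<2} = {0, 1::nat}" by auto
  have V: "vertices (complete_graph 2) = {0, 1}" by (simp add: complete_graph_def 2)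
  obtain k where k: "homeomorphic_map S3 S3 k" "orientation_preserving k"
    "k ` f ` closed_edge {0, 1} = f ` closed_edge {0, 1}"
    "k (f (vertex_point 0)) = f (vertex_point 1)" "k (f (vertex_point 1)) = f (vertex_point 0)"
    using flip_tame_arc[OF assms] .
  have top: "topspace (realization (complete_graph 2)) = closed_edge {0, 1}"
    unfolding realization_complete_graph_2 closed_edge_01 by simp
  have swap: "(\<lambda>x\<in>{..<2::nat}. 1 - x) ` {0, 1} = {0, 1}" by (auto simp: 2)
  have "graph_homeomorphism (complete_graph 2) f k"
    unfolding graph_homeomorphism_def top edges_complete_graph_2 V using k by auto
  moreover have "induces (complete_graph 2) f k (\<lambda>x\<in>{..<2}. 1 - x)"
    unfolding induces_def edges_complete_graph_2 V using k swap by auto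
  ultimately have "\<exists>h. graph_homeomorphism (complete_graph 2) f h \<and> orientation_preserving h \<and>
      induces (complete_graph 2) f h \<sigma>" if "\<sigma> \<in> Bij {..<2}" for \<sigma>
    using that k(2) identity_induced[of 2 f] unfolding Bij_2 by blast
  then show "TSG (complete_graph 2) f = BijGroup {..<2}" "TSG_plus (complete_graph 2) f = BijGroup {..<2}"
    using TSG_eq_BijGroup[of 2 f] by blast+
qed

theorem mainTheorem1:
  fixes G :: "('a, 'b) monoid_scheme"
  assumes "group G"
  shows "(realizable (complete_graph 1) G \<longleftrightarrow> trivial_group G) \<and>
         (positively_realizable (complete_graph 1) G \<longleftrightarrow> trivial_group G) \<and>
         (realizable (complete_graph 2) G \<longleftrightarrow> G \<cong> integer_mod_group 2) \<and>
         (positively_realizable (complete_graph 2) G \<longleftrightarrow> G \<cong> integer_mod_group 2)"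
proof -
  \<comment> \<open>The groups are the same for all tame embeddings, so realizability reduces to an
    isomorphism with one fixed group once some tame embedding exists.\<close>
  have ex: "\<exists>f. tame_embedding (complete_graph 1) f" "\<exists>f. tame_embedding (complete_graph 2) f"
    using tame_embedding_exists[OF realization_complete_graph_1] tame_embedding_exists[OF realization_complete_graph_2]
    by auto
  have "trivial_group (BijGroup {..<1::nat})"
    unfolding trivial_group_def using group_BijGroup[of "{..<1::nat}"] by (simp add: BijGroup_def Bij_1[unfolded One_nat_def])
  then have 1: "BijGroup {..<1::nat} \<cong> G \<longleftrightarrow> trivial_group G"
    using isomorphic_group_triviality1 trivial_groups_iso assms by blast
  have 2: "BijGroup {..<2::nat} \<cong> G \<longleftrightarrow> G \<cong> integer_mod_group 2"
    using BijGroup_2_iso iso_trans group.iso_sym group_BijGroup group_integer_mod_group assms by metis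
  show ?thesis
    unfolding realizable_def positively_realizable_def TSG_complete_graph_1 1
    using ex TSG_complete_graph_2 2 by metis
qed

end
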